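(* Let $n\ge1$. For any $a_1,a_2,a_3,a_4>0$, the space of invariant spinors on $(S^{4n-1}=\mathrm{Sp}(n)/\mathrm{Sp}(n-1),g_{\vec a})$ is $$\Sigma_{\mathrm{inv}}=\mathrm{span}_{\mathbb C}\{\omega^j,\ y_1\wedge\omega^j\}_{j=0}^{n-1},\qquad \omega:=\sum_{i=1}^{n-1}y_{2i}\wedge y_{2i+1}.$$
   Context: Matrices are $n\times n$ over the quaternions. $E_{i,j}$ has $-1$ in position $(i,j)$, $+1$ in $(j,i)$; $F_{i,j}$ ($i\ne j$) has $1$ in $(i,j)$ and $(j,i)$; $F_{i,i}$ has $1$ in $(i,i)$; other entries zero. $B_0(X_1,X_2)=-\mathrm{Re}\,\mathrm{tr}(X_1X_2)$. $\mathrm{Sp}(n-1)\subset\mathrm{Sp}(n)$ is the lower right block, $\mathfrak h=\mathfrak{sp}(n-1)$, $\mathfrak m=\mathfrak h^{\perp_{B_0}}=\bigoplus_{r=1}^4\mathfrak m_r$ with $\mathfrak m_1=\mathbb R iF_{1,1}$, $\mathfrak m_2=\mathbb R kF_{1,1}$, $\mathfrak m_3=\mathbb R jF_{1,1}$, $\mathfrak m_4=\mathrm{span}_{\mathbb R}\{iF_{1,p},jF_{1,p},kF_{1,p},E_{1,p}\}_{p=2}^n$, and $g_{\vec a}=\sum_{r=1}^4a_rB_0|_{\mathfrak m_r\times\mathfrak m_r}$. A $g_{\vec a}$-orthonormal basis is $e_1=\frac1{\sqrt{a_1}}iF_{1,1}$, $e_2=-\frac1{\sqrt{a_2}}kF_{1,1}$,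 $e_3=\frac1{\sqrt{a_3}}jF_{1,1}$, $e_{4p}=\frac1{\sqrt{2a_4}}jF_{1,p+1}$, $e_{4p+1}=\frac1{\sqrt{2a_4}}kF_{1,p+1}$, $e_{4p+2}=\frac1{\sqrt{2a_4}}iF_{1,p+1}$, $e_{4p+3}=\frac1{\sqrt{2a_4}}E_{1,p+1}$ ($p=1,\dots,n-1$). Spin module: $x_j=\frac1{\sqrt2}(e_{2j}-ie_{2j+1})$, $y_j=\frac1{\sqrt2}(e_{2j}+ie_{2j+1})$ ($1\le j\le2n-1$), $\Sigma=\Lambda^\bullet\mathrm{span}_{\mathbb C}\{y_1,\dots,y_{2n-1}\}$, $e_{2j}\cdot\eta=i(x_j\lrcorner\eta+y_j\wedge\eta)$, $e_{2j+1}\cdot\eta=y_j\wedge\eta-x_j\lrcorner\eta$, $e_1\cdot\eta=i\eta$ (even degree), $-i\eta$ (odd degree), where $x_j\lrcorner$ is the antiderivation with $x_j\lrcorner y_k=\delta_{jk}$. The spin lift of the skew endomorphism $e_i\wedge e_j$ ($e_i\mapsto e_j$, $e_j\mapsto-e_i$) is $\frac12e_i\cdot e_j$. Invariant spinors are the constant $H$-equivariant maps $G\to\Sigma$; equivalently ($H$ connected) $\Sigma_{\mathrm{inv}}=\{\psi\in\Sigma:\widetilde{\mathrm{ad}(h)|_{\mathfrak m}}\cdot\psi=0\ \forall h\in\mathfrak h\}$. Powers of $\omega$ are wedge powers, $\omega^0=1$. *)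

theory Defs
  imports
    "HOL-Analysis.Analysis"
    "HOL-Library.Function_Algebras"
    "Jordan_Normal_Form.Matrix"
begin

section \<open>Quaternions\<close>

text \<open>\<open>Quat a b c d\<close> is the quaternion \<open>a + b i + c j + d k\<close>.\<close>

datatype quat = Quat (qRe: real) (qI: real) (qJ: real) (qK: real)

instantiation quat :: ring_1
begin

definition zero_quat :: quat where "0 = Quat 0 0 0 0"

definition one_quat :: quat where "1 = Quat 1 0 0 0"

definition plus_quat :: "quat \<Rightarrow> quat \<Rightarrow> quat" where
  "x + y = Quat (qRe x + qRe y) (qI x + qI y) (qJ x + qJ y) (qK x + qK y)"

definition minus_quat :: "quat \<Rightarrow> quat \<Rightarrow> quat" where
  "x - y = Quat (qRe x - qRe y) (qI x - qI y) (qJ x - qJ y) (qK x - qK y)"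

definition uminus_quat :: "quat \<Rightarrow> quat" where
  "- x = Quat (- qRe x) (- qI x) (- qJ x) (- qK x)"

definition times_quat :: "quat \<Rightarrow> quat \<Rightarrow> quat" where
  "x * y = Quat
     (qRe x * qRe y - qI x * qI y - qJ x * qJ y - qK x * qK y)
     (qRe x * qI y + qI x * qRe y + qJ x * qK y - qK x * qJ y)
     (qRe x * qJ y - qI x * qK y + qJ x * qRe y + qK x * qI y)
     (qRe x * qK y + qI x * qJ y - qJ x * qI y + qK x * qRe y)"

instance
  by standard
    (auto simp: zero_quat_def one_quat_def plus_quat_def minus_quat_def uminus_quat_def
       times_quat_def algebra_simps)

end

instantiation quat :: real_algebra_1
begin

definition scaleR_quat :: "real \<Rightarrow> quat \<Rightarrow> quat" where
  "c *\<^sub>R x = Quat (c * qRe x) (c * qI x) (c * qJ x) (c * qK x)"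

instance
  by standard
    (auto simp: scaleR_quat_def one_quat_def zero_quat_def plus_quat_def times_quat_def
       algebra_simps)

end

definition quat_i :: quat where "quat_i = Quat 0 1 0 0"

definition quat_j :: quat where "quat_j = Quat 0 0 1 0"

definition quat_k :: quat where "quat_k = Quat 0 0 0 1"

lemma quat_units_mult:
  "quat_i * quat_i = -1" "quat_j * quat_j = -1" "quat_k * quat_k = -1"
  "quat_i * quat_j = quat_k" "quat_j * quat_k = quat_i" "quat_k * quat_i = quat_j"
  "quat_j * quat_i = - quat_k" "quat_k * quat_j = - quat_i" "quat_i * quat_k = - quat_j"
  by (simp_all add: quat_i_def quat_j_def quat_k_def one_quat_def uminus_quat_def times_quat_def)

definition quat_cnj :: "quat \<Rightarrow> quat" where
  "quat_cnj x = Quat (qRe x) (- qI x) (- qJ x) (- qK x)"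


section \<open>The homogeneous space \<open>Sp(n)/Sp(n-1)\<close> at the Lie algebra level\<close>

text \<open>
  The row and column arguments of \<open>E_mat\<close> and \<open>F_mat\<close> count from 1; the entries of the
  library's matrices are indexed from 0.
\<close>

definition E_mat :: "nat \<Rightarrow> nat \<Rightarrow> nat \<Rightarrow> quat mat" where
  "E_mat n p q = mat n n (\<lambda>(r, s).
     if (Suc r, Suc s) = (p, q) then -1 else if (Suc r, Suc s) = (q, p) then 1 else 0)"

definition F_mat :: "nat \<Rightarrow> nat \<Rightarrow> nat \<Rightarrow> quat mat" where
  "F_mat n p q = mat n n (\<lambda>(r, s).
     if (Suc r, Suc s) = (p, q) \<or> (Suc r, Suc s) = (q, p) then 1 else 0)"

definition quat_trace :: "quat mat \<Rightarrow> quat" where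
  "quat_trace X = (\<Sum>r<dim_row X. X $$ (r, r))"

definition quat_adjoint :: "quat mat \<Rightarrow> quat mat" where
  "quat_adjoint X = map_mat quat_cnj (transpose_mat X)"

definition B0 :: "quat mat \<Rightarrow> quat mat \<Rightarrow> real" where
  "B0 X Y = - qRe (quat_trace (X * Y))"

definition sp_alg :: "nat \<Rightarrow> quat mat set" where
  "sp_alg n = {X \<in> carrier_mat n n. quat_adjoint X = - X}"

definition h_alg :: "nat \<Rightarrow> quat mat set" where
  "h_alg n = {four_block_mat (0\<^sub>m 1 1) (0\<^sub>m 1 (n - 1)) (0\<^sub>m (n - 1) 1) Y | Y. Y \<in> sp_alg (n - 1)}"

definition m_space :: "nat \<Rightarrow> quat mat set" where
  "m_space n = {X \<in> sp_alg n. \<forall>Y \<in> h_alg n. B0 X Y = 0}"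

inductive_set real_span :: "nat \<Rightarrow> quat mat set \<Rightarrow> quat mat set" for n S where
  zero: "0\<^sub>m n n \<in> real_span n S"
| step: "X \<in> S \<Longrightarrow> Y \<in> real_span n S \<Longrightarrow> of_real c \<cdot>\<^sub>m X + Y \<in> real_span n S"

definition m_summand :: "nat \<Rightarrow> nat \<Rightarrow> quat mat set" where
  "m_summand n r =
     (if r = 1 then real_span n {quat_i \<cdot>\<^sub>m F_mat n 1 1}
      else if r = 2 then real_span n {quat_k \<cdot>\<^sub>m F_mat n 1 1}
      else if r = 3 then real_span n {quat_j \<cdot>\<^sub>m F_mat n 1 1}
      else real_span n (\<Union>p \<in> {2..n}.
        {quat_i \<cdot>\<^sub>m F_mat n 1 p, quat_j \<cdot>\<^sub>m F_mat n 1 p, quat_k \<cdot>\<^sub>m F_mat n 1 p, E_mat n 1 p}))"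

text \<open>The component in the \<open>r\<close>-th summand of an element of the direct sum.\<close>

definition m_component :: "nat \<Rightarrow> nat \<Rightarrow> quat mat \<Rightarrow> quat mat" where
  "m_component n r X = (THE Z. \<exists>Y. (\<forall>s \<in> {1..4}. Y s \<in> m_summand n s) \<and>
     X = Y 1 + Y 2 + Y 3 + Y 4 \<and> Z = Y r)"

definition metric :: "nat \<Rightarrow> (nat \<Rightarrow> real) \<Rightarrow> quat mat \<Rightarrow> quat mat \<Rightarrow> real" where
  "metric n a X Y = (\<Sum>r = 1..4. a r * B0 (m_component n r X) (m_component n r Y))"

text \<open>
  The orthonormal basis \<open>e 1, \<dots>, e (4 * n - 1)\<close>; an index \<open>l \<ge> 4\<close> is
  \<open>4 * p + l mod 4\<close> with \<open>p = l div 4\<close>.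
\<close>

definition e_vec :: "nat \<Rightarrow> (nat \<Rightarrow> real) \<Rightarrow> nat \<Rightarrow> quat mat" where
  "e_vec n a l =
     (if l = 1 then of_real (1 / sqrt (a 1)) \<cdot>\<^sub>m (quat_i \<cdot>\<^sub>m F_mat n 1 1)
      else if l = 2 then of_real (- (1 / sqrt (a 2))) \<cdot>\<^sub>m (quat_k \<cdot>\<^sub>m F_mat n 1 1)
      else if l = 3 then of_real (1 / sqrt (a 3)) \<cdot>\<^sub>m (quat_j \<cdot>\<^sub>m F_mat n 1 1)
      else of_real (1 / sqrt (2 * a 4)) \<cdot>\<^sub>m
        (let p = l div 4 in
         if l mod 4 = 0 then quat_j \<cdot>\<^sub>m F_mat n 1 (p + 1)
         else if l mod 4 = 1 then quat_k \<cdot>\<^sub>m F_mat n 1 (p + 1)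
         else if l mod 4 = 2 then quat_i \<cdot>\<^sub>m F_mat n 1 (p + 1)
         else E_mat n 1 (p + 1)))"

definition ad_m :: "nat \<Rightarrow> quat mat \<Rightarrow> quat mat \<Rightarrow> quat mat" where
  "ad_m n h = (\<lambda>X \<in> m_space n. h * X - X * h)"


section \<open>The spin module\<close>

text \<open>
  An element of the exterior algebra on \<open>y 1, y 2, \<dots>\<close> is given by its coefficients:
  \<open>\<eta> {s1, \<dots>, sk}\<close> with \<open>s1 < \<dots> < sk\<close> is the coefficient of
  \<open>y s1 \<and> \<dots> \<and> y sk\<close>.  Addition is pointwise.
\<close>

type_synonym multivector = "nat set \<Rightarrow> complex"

definition mv_scale :: "complex \<Rightarrow> multivector \<Rightarrow> multivector" where
  "mv_scale c \<eta> = (\<lambda>S. c * \<eta> S)"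

interpretation multivector: vector_space mv_scale
  by unfold_locales (auto simp: mv_scale_def fun_eq_iff algebra_simps)

definition mv_span :: "multivector set \<Rightarrow> multivector set" where
  "mv_span = Modules.module.span mv_scale"

definition mv_one :: multivector where
  "mv_one = (\<lambda>S. if S = {} then 1 else 0)"

definition y_vec :: "nat \<Rightarrow> multivector" where
  "y_vec j = (\<lambda>S. if S = {j} then 1 else 0)"

text \<open>
  The sign is that of the permutation sorting the elements of \<open>T\<close> followed by those of \<open>S - T\<close>.
\<close>

definition wedge :: "multivector \<Rightarrow> multivector \<Rightarrow> multivector" where
  "wedge \<eta> \<zeta> = (\<lambda>S. \<Sum>T \<in> Pow S.
     (-1) ^ card {(t, u). t \<in> T \<and> u \<in> S - T \<and> u < t} * \<eta> T * \<zeta> (S - T))"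

fun wedge_power :: "multivector \<Rightarrow> nat \<Rightarrow> multivector" where
  "wedge_power \<eta> 0 = mv_one"
| "wedge_power \<eta> (Suc k) = wedge \<eta> (wedge_power \<eta> k)"

text \<open>
  The antiderivation \<open>x j \<lrcorner>\<close> in terms of coefficients; it is determined by
  \<open>contract_one\<close> and \<open>contract_wedge_y_vec\<close>.
\<close>

definition contract :: "nat \<Rightarrow> multivector \<Rightarrow> multivector" where
  "contract j \<eta> = (\<lambda>S. if j \<in> S then 0 else (-1) ^ card {s \<in> S. s < j} * \<eta> (insert j S))"

lemma wedge_y_vec:
  assumes "finite S"
  shows "wedge (y_vec k) \<eta> S =
    (if k \<in> S then (-1) ^ card {s \<in> S. s < k} * \<eta> (S - {k}) else 0)"
proof -
  have "wedge (y_vec k) \<eta> S = (\<Sum>T \<in> Pow S. if T = {k}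
      then (-1) ^ card {(t, u). t \<in> T \<and> u \<in> S - T \<and> u < t} * \<eta> (S - T) else 0)"
    unfolding wedge_def y_vec_def by (intro sum.cong) auto
  also have "\<dots> = (if k \<in> S
      then (-1) ^ card {(t, u). t \<in> {k} \<and> u \<in> S - {k} \<and> u < t} * \<eta> (S - {k}) else 0)"
    using assms by (subst sum.delta) auto
  also have "{(t, u). t \<in> {k} \<and> u \<in> S - {k} \<and> u < t} = Pair k ` {s \<in> S. s < k}"
    by auto
  also have "card \<dots> = card {s \<in> S. s < k}"
    by (intro card_image inj_onI) auto
  finally show ?thesis .
qed

lemma contract_one: "contract j mv_one = 0"
  by (auto simp: contract_def mv_one_def fun_eq_iff)

lemma contract_wedge_y_vec:
  assumes "finite S"
  shows "contract j (wedge (y_vec k) \<eta>) S =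
    (if j = k then \<eta> S else 0) - wedge (y_vec k) (contract j \<eta>) S"
proof (cases "j = k")
  case True
  have set1: "{s \<in> insert k S. s < k} = {s \<in> S. s < k}"
    and set2: "{s \<in> S - {k}. s < k} = {s \<in> S. s < k}" by auto
  define c :: complex where "c = (-1) ^ card {s \<in> S. s < k}"
  have cc: "c * (c * x) = x" for x
    unfolding c_def by (cases "even (card {s \<in> S. s < k})") auto
  show ?thesis
  proof (cases "k \<in> S")
    case in_S: True
    have "wedge (y_vec k) (contract k \<eta>) S = c * (c * \<eta> S)"
      using in_S unfolding wedge_y_vec[OF assms] contract_def set2 c_def
      by (simp only: if_True if_False Diff_iff singletonI not_True_eq_False conj_ac simp_thms
        insert_Diff)
    then show ?thesis using True in_S cc by (simp add: contract_def)
  next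
    case notin_S: False
    have "contract k (wedge (y_vec k) \<eta>) S = c * (c * \<eta> S)"
      using notin_S set1 wedge_y_vec[of "insert k S" k \<eta>] assms
      unfolding contract_def c_def by (simp only: finite_insert if_False insertI1 if_True
        Diff_insert_absorb simp_thms)
    then show ?thesis using True notin_S assms cc by (simp add: wedge_y_vec)
  qed
next
  case False
  show ?thesis
  proof (cases "k \<in> S \<and> j \<notin> S")
    case True
    have del: "insert j S - {k} = insert j (S - {k})" using False by auto
    have "(-1::complex) ^ card {s \<in> S. s < j} * (-1) ^ card {s \<in> insert j S. s < k} =
      - ((-1) ^ card {s \<in> S. s < k} * (-1) ^ card {s \<in> S - {k}. s < j})"
    proof (cases "k < j")
      case lt: True
      have "{s \<in> S. s < j} = insert k {s \<in> S - {k}. s < j}" using True lt by auto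
      then have "card {s \<in> S. s < j} = Suc (card {s \<in> S - {k}. s < j})"
        using assms by simp
      moreover have "{s \<in> insert j S. s < k} = {s \<in> S. s < k}" using lt by auto
      ultimately show ?thesis by (simp add: mult.commute)
    next
      case ge: False
      have "{s \<in> insert j S. s < k} = insert j {s \<in> S. s < k}" using False ge by auto
      then have "card {s \<in> insert j S. s < k} = Suc (card {s \<in> S. s < k})"
        using assms True by simp
      moreover have "{s \<in> S - {k}. s < j} = {s \<in> S. s < j}" using ge by auto
      ultimately show ?thesis by (simp add: mult.commute)
    qed
    note signs = this
    have "contract j (wedge (y_vec k) \<eta>) S = (-1) ^ card {s \<in> S. s < j} *
        (-1) ^ card {s \<in> insert j S. s < k} * \<eta> (insert j S - {k})"
      using True wedge_y_vec[of "insert j S" k \<eta>] assms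
      unfolding contract_def by (simp only: finite_insert insertI2 if_True if_False
        mult.assoc simp_thms)
    moreover have "wedge (y_vec k) (contract j \<eta>) S = (-1) ^ card {s \<in> S. s < k} *
        (-1) ^ card {s \<in> S - {k}. s < j} * \<eta> (insert j (S - {k}))"
      using True unfolding wedge_y_vec[OF assms] contract_def
      by (simp only: if_True if_False Diff_iff mult.assoc simp_thms)
    ultimately show ?thesis
      using False signs del by simp
  next
    case False': False
    then show ?thesis
      using assms False by (auto simp: contract_def wedge_y_vec)
  qed
qed

definition spin_module :: "nat \<Rightarrow> multivector set" where
  "spin_module n = {\<eta>. \<forall>S. \<eta> S \<noteq> 0 \<longrightarrow> S \<subseteq> {1..2 * n - 1}}"

text \<open>Clifford multiplication by \<open>e l\<close>.\<close>

definition clifford :: "nat \<Rightarrow> multivector \<Rightarrow> multivector" where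
  "clifford l \<eta> =
     (if l = 1 then (\<lambda>S. if even (card S) then \<i> * \<eta> S else - \<i> * \<eta> S)
      else if even l then mv_scale \<i> (contract (l div 2) \<eta> + wedge (y_vec (l div 2)) \<eta>)
      else wedge (y_vec (l div 2)) \<eta> - contract (l div 2) \<eta>)"

text \<open>
  With respect to an orthonormal basis a skew endomorphism \<open>A\<close> is the sum over \<open>i < j\<close> of
  \<open>metric (A (e i)) (e j)\<close> times \<open>e i \<and> e j\<close>, where \<open>e i \<and> e j\<close> maps \<open>e i\<close> to \<open>e j\<close> and
  \<open>e j\<close> to \<open>- e i\<close>; the spin lift sends \<open>e i \<and> e j\<close> to one half of the Clifford product
  \<open>e i \<cdot> e j\<close>.
\<close>

definition spin_lift ::
    "nat \<Rightarrow> (nat \<Rightarrow> real) \<Rightarrow> (quat mat \<Rightarrow> quat mat) \<Rightarrow> multivector \<Rightarrow> multivector" where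
  "spin_lift n a A \<eta> = (\<Sum>i \<in> {1..4 * n - 1}. \<Sum>j \<in> {i<..4 * n - 1}.
     mv_scale (of_real (metric n a (A (e_vec n a i)) (e_vec n a j)))
       (mv_scale (1/2) (clifford i (clifford j \<eta>))))"

text \<open>
  Since \<open>Sp(n-1)\<close> is connected, a spinor is invariant iff it is annihilated by the spin lift of
  the isotropy representation of its Lie algebra.
\<close>

definition invariant_spinors :: "nat \<Rightarrow> (nat \<Rightarrow> real) \<Rightarrow> multivector set" where
  "invariant_spinors n a =
     {\<psi> \<in> spin_module n. \<forall>h \<in> h_alg n. spin_lift n a (ad_m n h) \<psi> = 0}"

definition omega :: "nat \<Rightarrow> multivector" where
  "omega n = (\<Sum>i = 1..n - 1. wedge (y_vec (2 * i)) (y_vec (2 * i + 1)))"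

end

theory Submission
  imports Defs
begin

text \<open>
  The isotropy algebra \<open>sp(n-1)\<close> acts on the summand \<open>m_4\<close>, a copy of the quaternionic column
  vectors of length \<open>n - 1\<close>, by left multiplication, and it kills the three lines \<open>m_1, m_2, m_3\<close>.
  The basis is arranged so that right multiplication by \<open>- i\<close> sends \<open>e (2j)\<close> to \<open>e (2j+1)\<close> for
  \<open>j \<ge> 2\<close>.  This complex structure commutes with the action, so the spin lift preserves the degree of
  multivectors: in terms of the creation operators \<open>b k = y k \<and> _\<close> and the annihilation operators
  \<open>a k = x k \<lrcorner> _\<close> it is a combination of operators \<open>b k a l\<close> with \<open>k, l \<ge> 2\<close>.  It is the action
  of \<open>sp(2n-2, C)\<close> on an exterior algebra, and the claim is that the invariants of this
  action are generated by the symplectic form \<open>\<omega>\<close>, the vector \<open>y 1\<close> being a spectator.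

  Everything is read off from coefficients.  Call \<open>2p\<close> and \<open>2p + 1\<close> partners, and write \<open>k'\<close> for the
  partner of \<open>k\<close>.  Call a set of indices \<^emph>\<open>paired\<close> if with any \<open>k \<ge> 2\<close> it contains \<open>k'\<close>.  The
  coefficient of \<open>\<omega>^j\<close> at a set \<open>S\<close> is \<open>j!\<close> if \<open>S\<close> is paired of size \<open>2j\<close>, and 0 otherwise
  (\<open>omega_power_coeff\<close>); the factor \<open>y 1\<close> adds the index 1 to these sets.  As the parity of the
  size of a paired set tells whether it contains 1, the right-hand side of the theorem is exactly the
  space \<open>degree_spinors\<close> of multivectors that are supported on paired sets and whose coefficients on
  those depend only on the size of the set (\<open>degree_spinors_eq_span\<close>).

  Such multivectors are invariant: on them, for \<open>k\<close> and \<open>l\<close> in different pairs, \<open>b k a l\<close>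
  agrees with \<open>b l' a k'\<close> up to the sign \<open>(-1)^(k+l)\<close> (\<open>degree_spinors_exchange\<close>), and the blocks of the spin lift, one for each entry of the
  matrix \<open>h\<close>, are combinations of exactly the differences that vanish by this, or for a diagonal
  entry because partners occur together (\<open>off_diagonal_block\<close>, \<open>diagonal_block\<close>).

  Conversely let \<open>\<psi>\<close> be invariant.  The matrix with the single entry \<open>i\<close> at \<open>(p, p)\<close> acts by a
  difference of number operators, so it multiplies the coefficient at \<open>S\<close> by a nonzero number
  whenever \<open>S\<close> contains just one of \<open>2p\<close>, \<open>2p + 1\<close>; hence \<open>\<psi>\<close> is supported on paired sets
  (\<open>invariant_support\<close>).  The real skew matrix with entries \<open>1\<close> and \<open>- 1\<close> at \<open>(q, p)\<close> and \<open>(p, q)\<close>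
  forces the coefficients at two paired sets to agree if one arises from the other by replacing the
  pair \<open>p\<close> by the pair \<open>q\<close> (\<open>invariant_exchange\<close>), and such replacements connect any two paired sets
  of the same size (\<open>invariant_depends_on_card\<close>).
\<close>

section \<open>Creation and annihilation operators\<close>

text \<open>
  The sign of moving \<open>y k\<close> to its place among the factors indexed by \<open>S\<close>.
\<close>

definition pass_sign :: "nat \<Rightarrow> nat set \<Rightarrow> complex" where
  "pass_sign k S = (-1) ^ card {s \<in> S. s < k}"

text \<open>
  The operator \<open>y k \<and> _\<close> without the finiteness proviso of \<open>wedge_y_vec\<close>: it agrees with the wedge
  product on multivectors that vanish at infinite sets, and it satisfies the anticommutation relations
  at every set, so that operators can be manipulated without side conditions.
\<close>

definition create :: "nat \<Rightarrow> multivector \<Rightarrow> multivector" where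
  "create k \<eta> = (\<lambda>S. if k \<in> S then pass_sign k S * \<eta> (S - {k}) else 0)"

definition finitary :: "multivector \<Rightarrow> bool" where
  "finitary \<eta> \<longleftrightarrow> (\<forall>S. infinite S \<longrightarrow> \<eta> S = 0)"

lemma pass_sign_insert:
  assumes "x \<notin> S"
  shows "pass_sign k (insert x S) = (if x < k then - pass_sign k S else pass_sign k S)"
proof (cases "x < k")
  case True
  then have "{s \<in> insert x S. s < k} = insert x {s \<in> S. s < k}" by auto
  then show ?thesis using True assms by (simp add: pass_sign_def)
next
  case False
  then have "{s \<in> insert x S. s < k} = {s \<in> S. s < k}" by auto
  then show ?thesis using False by (simp add: pass_sign_def)
qed

lemma pass_sign_Suc: "k \<notin> S \<Longrightarrow> pass_sign (Suc k) S = pass_sign k S"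
  unfolding pass_sign_def by (rule arg_cong[where f = "\<lambda>A. (-1) ^ card A"]) (auto simp: less_Suc_eq)

lemma pass_sign_square: "pass_sign k S * (pass_sign k S * z) = z"
  unfolding pass_sign_def by (cases "even (card {s \<in> S. s < k})") auto

lemma pass_sign_nonzero: "pass_sign k S \<noteq> 0"
  unfolding pass_sign_def by simp

lemma pass_sign_eq_one: "(\<And>s. s \<in> S \<Longrightarrow> k \<le> s) \<Longrightarrow> pass_sign k S = 1"
proof -
  assume "\<And>s. s \<in> S \<Longrightarrow> k \<le> s"
  then have "{s \<in> S. s < k} = {}" by force
  then show ?thesis by (simp only: pass_sign_def card.empty power_0)
qed

lemma contract_eq: "contract k \<eta> S = (if k \<in> S then 0 else pass_sign k S * \<eta> (insert k S))"
  by (simp add: contract_def pass_sign_def)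

lemma wedge_eq_create:
  assumes "finitary \<eta>"
  shows "wedge (y_vec k) \<eta> = create k \<eta>"
proof
  fix S
  show "wedge (y_vec k) \<eta> S = create k \<eta> S"
  proof (cases "finite S")
    case True
    then show ?thesis by (simp add: wedge_y_vec create_def pass_sign_def)
  next
    case False
    moreover from False have "wedge (y_vec k) \<eta> S = 0" by (simp add: wedge_def)
    ultimately show ?thesis using assms by (simp add: create_def finitary_def)
  qed
qed

lemma finitary_closed [simp]:
  "finitary \<eta> \<Longrightarrow> finitary (create k \<eta>)"
  "finitary \<eta> \<Longrightarrow> finitary (contract k \<eta>)"
  "finitary \<eta> \<Longrightarrow> finitary (mv_scale c \<eta>)"
  "finitary \<eta> \<Longrightarrow> finitary \<zeta> \<Longrightarrow> finitary (\<eta> + \<zeta>)"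
  "finitary \<eta> \<Longrightarrow> finitary \<zeta> \<Longrightarrow> finitary (\<eta> - \<zeta>)"
  by (auto simp: finitary_def create_def contract_def mv_scale_def)

lemma finitary_spin_module: "\<eta> \<in> spin_module n \<Longrightarrow> finitary \<eta>"
  unfolding spin_module_def finitary_def by (metis (mono_tags, lifting) finite_atLeastAtMost mem_Collect_eq rev_finite_subset)

text \<open>
  The canonical anticommutation relations.  They are used to move annihilation operators to the right.
\<close>

lemma contract_create:
  "contract j (create k \<eta>) S = (if j = k then \<eta> S else 0) - create k (contract j \<eta>) S"
proof (cases "j = k")
  case True
  show ?thesis
  proof (cases "k \<in> S")
    case in_S: True
    define T where "T = S - {k}"
    have S: "S = insert k T" "k \<notin> T" using in_S by (auto simp: T_def)
    then show ?thesis using True by (simp add: contract_eq create_def pass_sign_insert pass_sign_square)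
  next
    case False
    then show ?thesis using True by (simp add: contract_eq create_def pass_sign_insert pass_sign_square)
  qed
next
  case False
  show ?thesis
  proof (cases "k \<in> S \<and> j \<notin> S")
    case True
    define T where "T = S - {k}"
    have S: "S = insert k T" "k \<notin> T" "j \<notin> T" using True by (auto simp: T_def)
    have "insert j (insert k T) - {k} = insert j T" using S False by auto
    then show ?thesis using False S
      by (auto simp: contract_eq create_def pass_sign_insert insert_commute[of k j])
  next
    case F: False
    then show ?thesis using False by (auto simp: contract_eq create_def)
  qed
qed

lemma create_linear:
  "create k (\<eta> + \<zeta>) = create k \<eta> + create k \<zeta>"
  "create k (\<eta> - \<zeta>) = create k \<eta> - create k \<zeta>"
  "create k (mv_scale c \<eta>) = mv_scale c (create k \<eta>)"
  by (auto simp: create_def mv_scale_def fun_eq_iff algebra_simps)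

lemma contract_linear:
  "contract k (\<eta> + \<zeta>) = contract k \<eta> + contract k \<zeta>"
  "contract k (\<eta> - \<zeta>) = contract k \<eta> - contract k \<zeta>"
  "contract k (mv_scale c \<eta>) = mv_scale c (contract k \<eta>)"
  by (auto simp: contract_def mv_scale_def fun_eq_iff algebra_simps)

lemma clifford_eq:
  assumes "finitary \<eta>" "l \<noteq> 1"
  shows "clifford l \<eta> = (if even l then mv_scale \<i> (contract (l div 2) \<eta> + create (l div 2) \<eta>)
    else create (l div 2) \<eta> - contract (l div 2) \<eta>)"
  using assms by (simp add: clifford_def wedge_eq_create)

lemma create_contract:
  assumes "k \<noteq> l"
  shows "create k (contract l \<eta>) S =
    (if k \<in> S \<and> l \<notin> S then pass_sign k S * pass_sign l (S - {k}) * \<eta> (insert l (S - {k})) else 0)"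
  using assms by (auto simp: create_def contract_eq)

section \<open>Paired index sets and the powers of \<open>\<omega>\<close>\<close>

definition paired :: "nat \<Rightarrow> nat set \<Rightarrow> bool" where
  "paired n S \<longleftrightarrow> S \<subseteq> {1..2 * n - 1} \<and> (\<forall>p\<in>{1..<n}. 2 * p \<in> S \<longleftrightarrow> 2 * p + 1 \<in> S)"

definition degree_spinors :: "nat \<Rightarrow> multivector set" where
  "degree_spinors n = {\<eta>. (\<forall>S. \<eta> S \<noteq> 0 \<longrightarrow> paired n S) \<and>
     (\<forall>S S'. paired n S \<longrightarrow> paired n S' \<longrightarrow> card S = card S' \<longrightarrow> \<eta> S = \<eta> S')}"

lemma degree_spinors_card:
  assumes "\<eta> \<in> degree_spinors n" "paired n S" "paired n S'" "card S = card S'"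
  shows "\<eta> S = \<eta> S'"
  using assms unfolding degree_spinors_def by blast

lemma degree_spinors_support:
  assumes "\<eta> \<in> degree_spinors n" "\<not> paired n S"
  shows "\<eta> S = 0"
  using assms unfolding degree_spinors_def by blast

lemma subset_pairs_cases:
  fixes x :: nat
  assumes "x \<in> {1..2 * n - 1}"
  obtains "x = 1" | p where "p \<in> {1..<n}" "x = 2 * p \<or> x = 2 * p + 1"
proof (cases "x = 1")
  case False
  have "x div 2 \<in> {1..<n}" "x = 2 * (x div 2) \<or> x = 2 * (x div 2) + 1"
    using assms False by auto
  then show ?thesis using that(2) by blast
qed (use that in blast)

text \<open>
  In particular the parity of the size decides whether 1 is an element.  This is why the coefficients
  of \<open>\<omega>^j\<close> and of \<open>y 1 \<and> \<omega>^j\<close> can be told apart by the size of the set alone.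
\<close>

lemma card_paired:
  assumes "paired n S"
  shows "card S = 2 * card {p \<in> {1..<n}. 2 * p \<in> S} + (if 1 \<in> S then 1 else 0)"
proof -
  let ?K = "{p \<in> {1..<n}. 2 * p \<in> S}"
  let ?A = "(\<lambda>p. 2 * p) ` ?K" and ?B = "(\<lambda>p. 2 * p + 1) ` ?K" and ?C = "S \<inter> {1}"
  have "(?A \<union> ?B) \<union> ?C = S"
  proof (rule sym, intro equalityI subsetI)
    fix x assume x: "x \<in> S"
    with assms have "x \<in> {1..2 * n - 1}" by (auto simp: paired_def)
    then show "x \<in> (?A \<union> ?B) \<union> ?C"
      by (rule subset_pairs_cases) (use x assms in \<open>auto simp: paired_def\<close>)
  qed (use assms in \<open>auto simp: paired_def\<close>)
  moreover have "card ((?A \<union> ?B) \<union> ?C) = card (?A \<union> ?B) + card ?C"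
    by (intro card_Un_disjoint) auto
  moreover have "card (?A \<union> ?B) = card ?A + card ?B"
    by (intro card_Un_disjoint) (auto, presburger)
  moreover have "card ?A = card ?K" "card ?B = card ?K"
    by (auto intro!: card_image inj_onI)
  moreover have "card ?C = (if 1 \<in> S then 1 else 0)" by auto
  ultimately show ?thesis by simp
qed

text \<open>
  No sign appears: the two indices are adjacent, so any other index is less than both or than none
  of them, and the transpositions come in pairs.
\<close>

lemma wedge_pair:
  assumes "finitary \<eta>"
  shows "wedge (wedge (y_vec r) (y_vec (Suc r))) \<eta> S =
    (if r \<in> S \<and> Suc r \<in> S then \<eta> (S - {r, Suc r}) else 0)"
proof (cases "finite S")
  case False
  then have "wedge (wedge (y_vec r) (y_vec (Suc r))) \<eta> S = 0" by (simp add: wedge_def)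
  moreover have "infinite (S - {r, Suc r})" using False by simp
  ultimately show ?thesis using assms unfolding finitary_def by auto
next
  case True
  have y: "wedge (y_vec r) (y_vec (Suc r)) T = (if T = {r, Suc r} then 1 else 0)" if "T \<subseteq> S" for T
  proof -
    have "finite T" using that True by (rule finite_subset)
    then have "wedge (y_vec r) (y_vec (Suc r)) T =
       (if r \<in> T then pass_sign r T * y_vec (Suc r) (T - {r}) else 0)"
      by (simp add: wedge_y_vec pass_sign_def)
    moreover have "pass_sign r {r, Suc r} = 1" by (rule pass_sign_eq_one) auto
    moreover have "r \<in> T \<and> T - {r} = {Suc r} \<longleftrightarrow> T = {r, Suc r}" by auto
    ultimately show ?thesis by (cases "T = {r, Suc r}") (auto simp: y_vec_def)
  qed
  have "wedge (wedge (y_vec r) (y_vec (Suc r))) \<eta> S = (\<Sum>T \<in> Pow S. if T = {r, Suc r}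
      then (-1) ^ card {(t, u). t \<in> T \<and> u \<in> S - T \<and> u < t} * \<eta> (S - T) else 0)"
    unfolding wedge_def[of _ \<eta>] by (intro sum.cong) (auto simp: y)
  also have "\<dots> = (if r \<in> S \<and> Suc r \<in> S
      then (-1) ^ card {(t, u). t \<in> {r, Suc r} \<and> u \<in> S - {r, Suc r} \<and> u < t} * \<eta> (S - {r, Suc r})
      else 0)"
    using True by (subst sum.delta) auto
  also have "{(t, u). t \<in> {r, Suc r} \<and> u \<in> S - {r, Suc r} \<and> u < t} = {r, Suc r} \<times> {s \<in> S. s < r}"
    by (auto simp: less_Suc_eq)
  also have "(-1::complex) ^ card \<dots> = 1"
    by (simp add: card_cartesian_product power_mult)
  finally show ?thesis by simp
qed

lemma sum_fun_apply: "(\<Sum>i\<in>A. f i) S = (\<Sum>i\<in>A. f i S)" for f :: "'i \<Rightarrow> 'a \<Rightarrow> 'b::comm_monoid_add"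
  by (induction A rule: infinite_finite_induct) auto

lemma wedge_sum_left: "wedge (\<Sum>i\<in>A. f i) \<eta> S = (\<Sum>i\<in>A. wedge (f i) \<eta> S)"
  unfolding wedge_def sum_fun_apply
  by (subst sum.swap) (simp add: sum_distrib_left sum_distrib_right)

lemma wedge_omega:
  assumes "finitary \<eta>"
  shows "wedge (omega n) \<eta> S = (\<Sum>p | p \<in> {1..<n} \<and> 2 * p \<in> S \<and> 2 * p + 1 \<in> S.
    \<eta> (S - {2 * p, 2 * p + 1}))"
proof -
  have "wedge (omega n) \<eta> S = (\<Sum>p \<in> {1..<n}. if 2 * p \<in> S \<and> 2 * p + 1 \<in> S
     then \<eta> (S - {2 * p, 2 * p + 1}) else 0)"
    unfolding omega_def wedge_sum_left
    by (intro sum.cong) (auto simp: wedge_pair[OF assms] atLeastLessThanSuc_atLeastAtMost[symmetric])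
  then show ?thesis by (simp add: sum.inter_filter[symmetric])
qed

lemma paired_remove_pair:
  assumes "p \<in> {1..<n}" "2 * p \<in> S" "2 * p + 1 \<in> S"
  shows "paired n (S - {2 * p, 2 * p + 1}) \<longleftrightarrow> paired n S"
proof -
  have "S - {2 * p, 2 * p + 1} \<subseteq> {1..2 * n - 1} \<longleftrightarrow> S \<subseteq> {1..2 * n - 1}"
    using assms(1) by auto
  moreover have "(2 * q \<in> S - {2 * p, 2 * p + 1}) = (q \<noteq> p \<and> 2 * q \<in> S)"
    "(2 * q + 1 \<in> S - {2 * p, 2 * p + 1}) = (q \<noteq> p \<and> 2 * q + 1 \<in> S)" for q
  proof -
    have "2 * q \<noteq> 2 * p + 1" "2 * q + 1 \<noteq> 2 * p" by presburger+
    then show "(2 * q \<in> S - {2 * p, 2 * p + 1}) = (q \<noteq> p \<and> 2 * q \<in> S)"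
      "(2 * q + 1 \<in> S - {2 * p, 2 * p + 1}) = (q \<noteq> p \<and> 2 * q + 1 \<in> S)" by auto
  qed
  ultimately show ?thesis using assms(2,3) by (simp only: paired_def) blast
qed

lemma finite_paired: "paired n S \<Longrightarrow> finite S"
  unfolding paired_def by (metis finite_atLeastAtMost finite_subset)

text \<open>
  By induction: a set of size \<open>2 j + 2\<close> loses one of its \<open>j + 1\<close> pairs in each summand of
  \<open>\<omega> \<and> \<omega>^j\<close>, and removing a pair neither creates nor destroys pairedness.
\<close>

lemma omega_power_coeff:
  "wedge_power (omega n) j = (\<lambda>S. if paired n S \<and> card S = 2 * j then fact j else 0)"
proof (induction j)
  case 0
  have "paired n S \<and> card S = 0 \<longleftrightarrow> S = {}" for S
    using finite_paired[of n S] by (auto simp: paired_def)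
  then show ?case by (auto simp: mv_one_def fun_eq_iff)
next
  case (Suc j)
  show ?case
  proof
    fix S
    let ?Q = "{p. p \<in> {1..<n} \<and> 2 * p \<in> S \<and> 2 * p + 1 \<in> S}"
    have fin: "finitary (wedge_power (omega n) j)"
      unfolding Suc.IH finitary_def by (auto dest: finite_paired)
    have "wedge_power (omega n) (Suc j) S = (\<Sum>p\<in>?Q. wedge_power (omega n) j (S - {2 * p, 2 * p + 1}))"
      using wedge_omega[OF fin] by simp
    also have "\<dots> = (\<Sum>p\<in>?Q. if paired n S \<and> card S = 2 * Suc j then fact j else 0)"
    proof (intro sum.cong refl)
      fix p assume p: "p \<in> ?Q"
      have "card S = card (S - {2 * p, 2 * p + 1}) + 2" if "finite S"
      proof -
        have "card (S - {2 * p, 2 * p + 1}) = card S - card {2 * p, 2 * p + 1}"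
          using p by (intro card_Diff_subset) auto
        moreover have "card {2 * p, 2 * p + 1} \<le> card S"
          using p that by (intro card_mono) auto
        ultimately show ?thesis by simp
      qed
      then show "wedge_power (omega n) j (S - {2 * p, 2 * p + 1}) =
          (if paired n S \<and> card S = 2 * Suc j then fact j else 0)"
        using p paired_remove_pair[of p n S] finite_paired[of n S] unfolding Suc.IH by auto
    qed
    also have "\<dots> = (if paired n S \<and> card S = 2 * Suc j then of_nat (card ?Q) * fact j else 0)"
      by simp
    also have "\<dots> = (if paired n S \<and> card S = 2 * Suc j then fact (Suc j) else 0)"
    proof (cases "paired n S \<and> card S = 2 * Suc j")
      case True
      then have "?Q = {p \<in> {1..<n}. 2 * p \<in> S}" unfolding paired_def by auto
      moreover have "card {p \<in> {1..<n}. 2 * p \<in> S} = Suc j"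
        using card_paired[of n S] True by (simp split: if_splits)
      ultimately have "card ?Q = Suc j" by simp
      then show ?thesis using True by (simp only: if_True fact_Suc of_nat_fact of_nat_mult simp_thms)
    qed auto
    finally show "wedge_power (omega n) (Suc j) S =
      (if paired n S \<and> card S = 2 * Suc j then fact (Suc j) else 0)" .
  qed
qed

lemma paired_remove_one:
  assumes "n \<ge> 1" "1 \<in> S"
  shows "paired n (S - {1}) \<longleftrightarrow> paired n S"
proof -
  have "S - {1} \<subseteq> {1..2 * n - 1} \<longleftrightarrow> S \<subseteq> {1..2 * n - 1}" using assms by auto
  moreover have "(2 * p \<in> S - {1}) = (2 * p \<in> S)" "(2 * p + 1 \<in> S - {1}) = (2 * p + 1 \<in> S)"
    if "p \<in> {1..<n}" for p using that by auto
  ultimately show ?thesis unfolding paired_def by metis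
qed

lemma y_omega_power_coeff:
  assumes "n \<ge> 1"
  shows "wedge (y_vec 1) (wedge_power (omega n) j) =
    (\<lambda>S. if paired n S \<and> card S = 2 * j + 1 then fact j else 0)"
proof
  fix S
  have "finitary (wedge_power (omega n) j)"
    unfolding omega_power_coeff finitary_def by (auto dest: finite_paired)
  then have eq: "wedge (y_vec 1) (wedge_power (omega n) j) S =
     (if 1 \<in> S then pass_sign 1 S * wedge_power (omega n) j (S - {1}) else 0)"
    by (simp only: wedge_eq_create create_def)
  show "wedge (y_vec 1) (wedge_power (omega n) j) S =
    (if paired n S \<and> card S = 2 * j + 1 then fact j else 0)"
  proof (cases "1 \<in> S \<and> paired n S")
    case True
    then have "pass_sign 1 S = 1" by (intro pass_sign_eq_one) (auto simp: paired_def)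
    moreover have "card S = Suc (card (S - {1}))"
      using True finite_paired[of n S] by (simp only: card.remove)
    ultimately show ?thesis
      using True paired_remove_one[OF assms, of S] unfolding eq by (simp add: omega_power_coeff)
  next
    case False
    have "even (card S)" if "paired n S" "1 \<notin> S"
      using card_paired[OF that(1)] that(2) by simp
    then show ?thesis
      using False paired_remove_one[OF assms, of S] unfolding eq by (auto simp: omega_power_coeff)
  qed
qed

text \<open>
  Both spaces have the same basis: for each \<open>k < 2 n\<close> the indicator function of the paired
  sets of size \<open>k\<close>, which up to a factorial is \<open>\<omega>^j\<close> for \<open>k = 2 j\<close> and \<open>y 1 \<and> \<omega>^j\<close> for
  \<open>k = 2 j + 1\<close>.
\<close>

lemma degree_spinors_eq_span:
  assumes "n \<ge> 1"
  shows "degree_spinors n = mv_span (\<Union>j \<in> {0..n - 1}.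
      {wedge_power (omega n) j, wedge (y_vec 1) (wedge_power (omega n) j)})"
    (is "_ = mv_span ?G")
proof
  have sub: "multivector.subspace (degree_spinors n)"
  proof (rule multivector.subspaceI)
    show "0 \<in> degree_spinors n" by (auto simp: degree_spinors_def)
  next
    fix x y assume "x \<in> degree_spinors n" "y \<in> degree_spinors n"
    then show "x + y \<in> degree_spinors n"
      unfolding degree_spinors_def mem_Collect_eq plus_fun_apply by (metis add.right_neutral)
  next
    fix c x assume "x \<in> degree_spinors n"
    then show "mv_scale c x \<in> degree_spinors n"
      unfolding degree_spinors_def mem_Collect_eq mv_scale_def by (metis mult_zero_right)
  qed
  have gens: "?G \<subseteq> degree_spinors n"
    unfolding y_omega_power_coeff[OF assms] unfolding omega_power_coeff degree_spinors_def by (auto split: if_splits)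
  show "mv_span ?G \<subseteq> degree_spinors n"
    unfolding mv_span_def by (rule multivector.span_minimal[OF gens sub])
next
  show "degree_spinors n \<subseteq> mv_span ?G"
  proof
    fix \<eta> assume \<eta>: "\<eta> \<in> degree_spinors n"
    \<comment> \<open>the common coefficient of \<open>\<eta>\<close> at the paired sets of size \<open>k\<close>\<close>
    define c where "c k = \<eta> (SOME S. paired n S \<and> card S = k)" for k
    have c: "\<eta> S = c (card S)" if "paired n S" for S
    proof -
      have "paired n (SOME T. paired n T \<and> card T = card S) \<and>
        card (SOME T. paired n T \<and> card T = card S) = card S"
        by (rule someI[of _ S]) (use that in simp)
      then show ?thesis using degree_spinors_card[OF \<eta> that, of "SOME T. paired n T \<and> card T = card S"]
        unfolding c_def by simp
    qed
    define T where "T = (\<Sum>j\<in>{0..n-1}.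
      mv_scale (c (2 * j) / fact j) (wedge_power (omega n) j) +
      mv_scale (c (2 * j + 1) / fact j) (wedge (y_vec 1) (wedge_power (omega n) j)))"
    have "\<eta> = T"
    proof
      fix S
      have T: "T S = (\<Sum>j\<in>{0..n-1}. if j = card S div 2 then (if paired n S then c (card S) else 0) else 0)"
        unfolding T_def sum_fun_apply y_omega_power_coeff[OF assms] unfolding omega_power_coeff
        by (intro sum.cong) (auto simp: mv_scale_def)
      show "\<eta> S = T S"
      proof (cases "paired n S")
        case True
        then have "card S \<le> card {1..2 * n - 1}"
          by (intro card_mono) (auto simp: paired_def)
        then have "card S div 2 \<in> {0..n - 1}" by auto
        then show ?thesis using True c unfolding T by simp
      next
        case False
        then show ?thesis using \<eta> unfolding T degree_spinors_def by auto
      qed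
    qed
    moreover have "T \<in> mv_span ?G"
      unfolding T_def mv_span_def
      by (intro multivector.span_sum multivector.span_add multivector.span_scale multivector.span_base) auto
    ultimately show "\<eta> \<in> mv_span ?G" by simp
  qed
qed

section \<open>Exchange relations\<close>

definition partner :: "nat \<Rightarrow> nat" where
  "partner k = (if even k then k + 1 else k - 1)"

lemma paired_iff_partner:
  "paired n S \<longleftrightarrow> S \<subseteq> {1..2 * n - 1} \<and> (\<forall>k\<in>{2..2 * n - 1}. k \<in> S \<longleftrightarrow> partner k \<in> S)"
proof -
  have "(\<forall>p\<in>{1..<n}. 2 * p \<in> S \<longleftrightarrow> 2 * p + 1 \<in> S) \<longleftrightarrow>
    (\<forall>k\<in>{2..2 * n - 1}. k \<in> S \<longleftrightarrow> partner k \<in> S)" (is "?L \<longleftrightarrow> ?R")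
  proof
    assume L: ?L
    show ?R
    proof
      fix k assume k: "k \<in> {2..2 * n - 1}"
      then have "k \<in> {1..2 * n - 1}" by simp
      then show "k \<in> S \<longleftrightarrow> partner k \<in> S"
      proof (rule subset_pairs_cases)
        fix p assume p: "p \<in> {1..<n}" "k = 2 * p \<or> k = 2 * p + 1"
        then have "2 * p \<in> S \<longleftrightarrow> 2 * p + 1 \<in> S" using L by blast
        then show ?thesis using p by (auto simp: partner_def)
      qed (use k in auto)
    qed
  next
    assume R: ?R
    show ?L
    proof
      fix p assume "p \<in> {1..<n}"
      then have "2 * p \<in> {2..2 * n - 1}" by auto
      then show "2 * p \<in> S \<longleftrightarrow> 2 * p + 1 \<in> S" using R by (force simp: partner_def)
    qed
  qed
  then show ?thesis by (simp add: paired_def)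
qed

lemma pass_sign_partner: "k \<noteq> 0 \<Longrightarrow> k \<notin> S \<Longrightarrow> partner k \<notin> S \<Longrightarrow> pass_sign (partner k) S = pass_sign k S"
  using pass_sign_Suc[of k S] pass_sign_Suc[of "k - 1" S] by (auto simp: partner_def)

lemma partner_range: "k \<in> {2..2 * n - 1} \<Longrightarrow> partner k \<in> {2..2 * n - 1}"
  unfolding partner_def atLeastAtMost_iff by presburger

lemma partner_partner: "k \<noteq> 0 \<Longrightarrow> partner (partner k) = k"
  unfolding partner_def by auto

lemma partner_neq: "k \<noteq> 0 \<Longrightarrow> partner k \<noteq> k"
  unfolding partner_def by auto

text \<open>
  Both operators fill \<open>k\<close> and \<open>l'\<close> on top of \<open>T\<close>, the first one from the pair of \<open>l\<close> and the second one
  from the pair of \<open>k\<close>.  Their signs are compared by deleting the indices one at a time.  Passing \<open>T\<close>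
  contributes the same sign to both, as partners pass the same elements of \<open>T\<close>.  Moreover exactly one
  of \<open>k < l'\<close> and \<open>l' < k\<close> holds, and \<open>l' < l\<close> and \<open>k < k'\<close> are decided by the parities of \<open>l\<close> and
  \<open>k\<close>.
\<close>

lemma exchange_coeffs:
  assumes "k \<noteq> 0" "l \<noteq> 0" "l \<noteq> k" "l \<noteq> partner k"
    and "T \<inter> {k, l, partner k, partner l} = {}"
  shows "\<exists>c. c \<noteq> 0 \<and>
      create k (contract l \<eta>) (insert k (insert (partner l) T)) = c * \<eta> (insert l (insert (partner l) T)) \<and>
      create (partner l) (contract (partner k) \<eta>) (insert k (insert (partner l) T)) =
        (-1) ^ (k + l) * c * \<eta> (insert k (insert (partner k) T))"
proof -
  have ne: "k \<noteq> partner l" "partner k \<noteq> partner l" "partner k \<noteq> k" "partner l \<noteq> l"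
    using assms partner_partner partner_neq by metis+
  have notin: "k \<notin> T" "l \<notin> T" "partner k \<notin> T" "partner l \<notin> T" using assms by auto
  let ?S = "insert k (insert (partner l) T)"
  have d1: "?S - {k} = insert (partner l) T" and d2: "?S - {partner l} = insert k T"
    using ne notin by auto
  let ?c = "pass_sign k (insert (partner l) T) * pass_sign l (insert (partner l) T)"
  have "create k (contract l \<eta>) ?S = ?c * \<eta> (insert l (insert (partner l) T))"
    using ne notin assms unfolding create_contract[OF assms(3)[symmetric]] d1 by (auto simp: pass_sign_insert)
  moreover have "create (partner l) (contract (partner k) \<eta>) ?S =
     (pass_sign (partner l) (insert k T) * pass_sign (partner k) (insert k T)) * \<eta> (insert k (insert (partner k) T))"
    using ne notin assms unfolding create_contract[OF ne(2)[symmetric]] d2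
    by (auto simp: pass_sign_insert insert_commute[of "partner k" k])
  moreover have "pass_sign (partner l) (insert k T) * pass_sign (partner k) (insert k T) = (-1) ^ (k + l) * ?c"
  proof -
    have "partner l < k \<longleftrightarrow> \<not> k < partner l" using ne by auto
    moreover have "partner l < l \<longleftrightarrow> odd l" "k < partner k \<longleftrightarrow> even k"
      using assms(1,2) by (auto simp: partner_def)
    ultimately show ?thesis
      using notin pass_sign_partner[of l T] pass_sign_partner[of k T] assms(1,2)
      by (cases "even k"; cases "even l"; cases "k < partner l") (simp_all add: pass_sign_insert power_add)
  qed
  moreover have "?c \<noteq> 0" by (simp add: pass_sign_nonzero)
  ultimately show ?thesis by (intro exI[of _ ?c]) (simp only: simp_thms)
qed

lemma paired_partner: "paired n S \<Longrightarrow> k \<in> {2..2 * n - 1} \<Longrightarrow> partner k \<in> S \<longleftrightarrow> k \<in> S"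
  by (simp add: paired_iff_partner)

lemma paired_insert_pair:
  assumes "k \<in> {2..2 * n - 1}" "k \<notin> T" "partner k \<notin> T"
  shows "paired n (insert k (insert (partner k) T)) \<longleftrightarrow> paired n T"
proof -
  define p where "p = k div 2"
  have p: "p \<in> {1..<n}" and kp: "{k, partner k} = {2 * p, 2 * p + 1}"
    using assms(1) by (auto simp: p_def partner_def)
  let ?S = "insert k (insert (partner k) T)"
  have "?S - {2 * p, 2 * p + 1} = T" unfolding kp[symmetric] using assms by auto
  moreover have "2 * p \<in> ?S" "2 * p + 1 \<in> ?S" using kp by blast+
  ultimately show ?thesis using paired_remove_pair[OF p, of ?S] by simp
qed

lemma degree_spinors_exchange_support:
  assumes \<eta>: "\<eta> \<in> degree_spinors n" and k: "k \<in> {2..2 * n - 1}" and l: "l \<in> {2..2 * n - 1}"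
    and neq: "l \<noteq> k" "l \<noteq> partner k"
    and nz: "create k (contract l \<eta>) S \<noteq> 0"
  shows "k \<in> S \<and> partner l \<in> S \<and> l \<notin> S \<and> partner k \<notin> S"
proof -
  have 0: "k \<noteq> 0" "l \<noteq> 0" using k l by auto
  have ne: "partner l \<noteq> k" "partner k \<noteq> k" "partner l \<noteq> l"
    using 0 neq partner_partner partner_neq by metis+
  have kS: "k \<in> S" "l \<notin> S" and "\<eta> (insert l (S - {k})) \<noteq> 0"
    using nz neq by (auto simp: create_contract split: if_splits)
  then have "paired n (insert l (S - {k}))" using degree_spinors_support[OF \<eta>] by blast
  then show ?thesis using paired_partner[OF _ k] paired_partner[OF _ l] kS ne neq by blast
qed

text \<open>
  This is the infinitesimal symplectic invariance of a multivector whose coefficients depend only on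
  the size of the set: by \<open>exchange_coeffs\<close> the two sides are, up to a common factor and the sign, coefficients
  of \<open>\<eta>\<close> at sets that differ by replacing one pair by another.
\<close>

lemma degree_spinors_exchange:
  assumes \<eta>: "\<eta> \<in> degree_spinors n" and k: "k \<in> {2..2 * n - 1}" and l: "l \<in> {2..2 * n - 1}"
    and neq: "l \<noteq> k" "l \<noteq> partner k"
  shows "create (partner l) (contract (partner k) \<eta>) S = (-1) ^ (k + l) * create k (contract l \<eta>) S"
proof -
  have nz: "k \<noteq> 0" "l \<noteq> 0" using k l by auto
  have ne: "k \<noteq> partner l" "partner k \<noteq> partner l" "partner k \<noteq> k" "partner l \<noteq> l"
    using nz neq partner_partner partner_neq by metis+
  show ?thesis
  proof (cases "k \<in> S \<and> partner l \<in> S \<and> l \<notin> S \<and> partner k \<notin> S")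
    case True
    define T where "T = S - {k, partner l}"
    have S: "S = insert k (insert (partner l) T)" and T: "T \<inter> {k, l, partner k, partner l} = {}"
      using True by (auto simp: T_def)
    let ?A = "insert l (insert (partner l) T)" and ?B = "insert k (insert (partner k) T)"
    have A: "paired n ?A \<longleftrightarrow> paired n T" and B: "paired n ?B \<longleftrightarrow> paired n T"
      using T k l by (intro paired_insert_pair; auto)+
    have "\<eta> ?A = \<eta> ?B"
    proof (cases "paired n T")
      case True
      moreover have "card ?A = card ?B"
        using finite_paired[OF True] ne T by auto
      ultimately show ?thesis using degree_spinors_card[OF \<eta>, of ?A ?B] A B by blast
    next
      case False
      then show ?thesis using degree_spinors_support[OF \<eta>] A B by simp
    qed
    then show ?thesis
      using exchange_coeffs[OF nz neq T, of \<eta>] unfolding S by (auto simp: power_add)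
  next
    case False
    have pp: "partner (partner k) = k" "partner (partner l) = l"
      using nz by (simp_all add: partner_partner)
    have "create k (contract l \<eta>) S = 0"
      using degree_spinors_exchange_support[OF \<eta> k l neq] False by blast
    moreover have "create (partner l) (contract (partner k) \<eta>) S = 0"
      using degree_spinors_exchange_support[OF \<eta> partner_range[OF l] partner_range[OF k]]
        ne False neq unfolding pp by metis
    ultimately show ?thesis by simp
  qed
qed

lemma create_contract_same: "create k (contract k \<eta>) S = (if k \<in> S then \<eta> S else 0)"
proof (cases "k \<in> S")
  case True
  define T where "T = S - {k}"
  have "S = insert k T" "k \<notin> T" using True by (auto simp: T_def)
  then show ?thesis by (simp add: contract_eq create_def pass_sign_insert pass_sign_square)
qed (simp add: create_def)

lemma degree_spinors_number:
  assumes \<eta>: "\<eta> \<in> degree_spinors n" and k: "k \<in> {2..2 * n - 1}"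
  shows "create (partner k) (contract (partner k) \<eta>) S = create k (contract k \<eta>) S"
  using paired_partner[OF _ k, of S] degree_spinors_support[OF \<eta>, of S]
  by (auto simp: create_contract_same)

lemma degree_spinors_partner:
  assumes \<eta>: "\<eta> \<in> degree_spinors n" and k: "k \<in> {2..2 * n - 1}"
  shows "create k (contract (partner k) \<eta>) S = 0"
proof -
  have "partner k \<noteq> k" using k by (intro partner_neq) auto
  then show ?thesis
    using paired_partner[OF _ k, of "insert (partner k) (S - {k})"]
      degree_spinors_support[OF \<eta>, of "insert (partner k) (S - {k})"]
    by (auto simp: create_contract)
qed

section \<open>Clifford products as quadratic expressions in creation and annihilation operators\<close>

definition qdot :: "quat \<Rightarrow> quat \<Rightarrow> real" where
  "qdot x y = qRe x * qRe y + qI x * qI y + qJ x * qJ y + qK x * qK y"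

text \<open>
  The quaternion occurring in the basis vector with index \<open>4 * p + s\<close>.
\<close>

definition quat_unit :: "nat \<Rightarrow> quat" where
  "quat_unit s = (if s = 0 then quat_j else if s = 1 then quat_k else if s = 2 then quat_i else 1)"

lemma clifford_four:
  assumes "finitary \<eta>" "p \<noteq> 0"
  shows "clifford (4 * p) \<eta> = mv_scale \<i> (contract (2 * p) \<eta> + create (2 * p) \<eta>)"
    "clifford (4 * p + 1) \<eta> = create (2 * p) \<eta> - contract (2 * p) \<eta>"
    "clifford (4 * p + 2) \<eta> = mv_scale \<i> (contract (2 * p + 1) \<eta> + create (2 * p + 1) \<eta>)"
    "clifford (4 * p + 3) \<eta> = create (2 * p + 1) \<eta> - contract (2 * p + 1) \<eta>"
proof -
  have d: "4 * p div 2 = 2 * p" "(4 * p + 1) div 2 = 2 * p" "(4 * p + 2) div 2 = 2 * p + 1"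
    "(4 * p + 3) div 2 = 2 * p + 1" by linarith+
  have e: "even (4 * p)" "odd (4 * p + 1)" "even (4 * p + 2)" "odd (4 * p + 3)" by auto
  have n: "4 * p \<noteq> 1" "4 * p + 1 \<noteq> 1" "4 * p + 2 \<noteq> 1" "4 * p + 3 \<noteq> 1"
    using assms(2) by auto
  show "clifford (4 * p) \<eta> = mv_scale \<i> (contract (2 * p) \<eta> + create (2 * p) \<eta>)"
    "clifford (4 * p + 1) \<eta> = create (2 * p) \<eta> - contract (2 * p) \<eta>"
    "clifford (4 * p + 2) \<eta> = mv_scale \<i> (contract (2 * p + 1) \<eta> + create (2 * p + 1) \<eta>)"
    "clifford (4 * p + 3) \<eta> = create (2 * p + 1) \<eta> - contract (2 * p + 1) \<eta>"
    unfolding clifford_eq[OF assms(1) n(1)] clifford_eq[OF assms(1) n(2)]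
      clifford_eq[OF assms(1) n(3)] clifford_eq[OF assms(1) n(4)] d
    using e by simp_all
qed

lemma sum_upto_four: "(\<Sum>s<4. f s) = f 0 + f 1 + f 2 + f 3" for f :: "nat \<Rightarrow> 'a::comm_monoid_add"
  by (simp add: eval_nat_numeral add.assoc)

lemmas quat_simps = quat_unit_def quat_i_def quat_j_def quat_k_def one_quat_def times_quat_def qdot_def

text \<open>
  The contribution of the pair of basis vectors \<open>4 * p + s\<close>, \<open>4 * q + t\<close> to the spin lift if the
  matrix entry at \<open>(q, p)\<close> is \<open>u\<close>; see \<open>isotropy_coefficient\<close> for the coefficient.
\<close>

definition clifford_term :: "nat \<Rightarrow> nat \<Rightarrow> quat \<Rightarrow> nat \<Rightarrow> nat \<Rightarrow> multivector \<Rightarrow> multivector" where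
  "clifford_term p q u s t \<eta> = mv_scale (of_real (qdot (u * quat_unit s) (quat_unit t)))
     (mv_scale (1/2) (clifford (4 * p + s) (clifford (4 * q + t) \<eta>)))"

text \<open>
  The terms with two creation or two annihilation operators cancel because left multiplication by \<open>u\<close>
  commutes with the complex structure, right multiplication by \<open>- i\<close>.  What is left consists of four
  combinations, each of which pairs \<open>b k a l\<close> with \<open>b l' a k'\<close>.
\<close>

lemma off_diagonal_block:
  assumes "finitary \<eta>" "p \<noteq> 0" "q \<noteq> 0" "p \<noteq> q"
  shows "(\<Sum>s<4. \<Sum>t<4. clifford_term p q (Quat \<alpha> \<beta> \<gamma> \<delta>) s t \<eta>) S =
    (\<alpha> - \<i> * \<beta>) * (create (2 * q) (contract (2 * p) \<eta>) S
       - create (2 * p + 1) (contract (2 * q + 1) \<eta>) S)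
    + (\<alpha> + \<i> * \<beta>) * (create (2 * q + 1) (contract (2 * p + 1) \<eta>) S
       - create (2 * p) (contract (2 * q) \<eta>) S)
    + (\<delta> + \<i> * \<gamma>) * (create (2 * p) (contract (2 * q + 1) \<eta>) S
       + create (2 * q) (contract (2 * p + 1) \<eta>) S)
    - (\<delta> - \<i> * \<gamma>) * (create (2 * q + 1) (contract (2 * p) \<eta>) S
       + create (2 * p + 1) (contract (2 * q) \<eta>) S)"
proof -
  have ne: "2 * p \<noteq> 2 * q" "2 * p \<noteq> 2 * q + 1" "2 * p + 1 \<noteq> 2 * q" "2 * p + 1 \<noteq> 2 * q + 1"
    using assms(4) by presburger+
  note cc = contract_create[of "2 * p" "2 * q"] contract_create[of "2 * p" "2 * q + 1"]
    contract_create[of "2 * p + 1" "2 * q"] contract_create[of "2 * p + 1" "2 * q + 1"]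
  show ?thesis
    using assms(1-3) ne unfolding sum_upto_four clifford_term_def
    apply (simp only: clifford_four[unfolded One_nat_def] add_0_right finitary_closed One_nat_def simp_thms)
    apply (simp only: create_linear contract_linear)
    \<comment> \<open>only now evaluate at \<open>S\<close>, where the anticommutation relations apply\<close>
    apply (simp only: plus_fun_apply fun_diff_def mv_scale_def cc[unfolded One_nat_def] One_nat_def if_False simp_thms)
    apply (simp add: quat_simps)
    apply (simp add: field_simps)
    done
qed

lemma create_create_same: "create k (create k \<eta>) S = 0"
  by (simp add: create_def)

lemma contract_contract_same: "contract k (contract k \<eta>) S = 0"
  by (simp add: contract_def)

text \<open>
  Here \<open>u\<close> is imaginary, and only the products of distinct basis vectors of the same quaternionic line
  occur.  The constants that arise from reordering \<open>b k a k\<close> cancel: the action of \<open>h\<close> on the complex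
  vector space of dimension \<open>2 n - 2\<close> has trace 0, so no determinant twist arises.
\<close>

lemma diagonal_block:
  assumes "finitary \<eta>" "p \<noteq> 0"
  shows "(\<Sum>s<4. \<Sum>t<4. if s < t then clifford_term p p (Quat 0 \<beta> \<gamma> \<delta>) s t \<eta> else 0) S =
    \<i> * \<beta> * (create (2 * p + 1) (contract (2 * p + 1) \<eta>) S - create (2 * p) (contract (2 * p) \<eta>) S)
    + (\<delta> + \<i> * \<gamma>) * create (2 * p) (contract (2 * p + 1) \<eta>) S
    - (\<delta> - \<i> * \<gamma>) * create (2 * p + 1) (contract (2 * p) \<eta>) S"
proof -
  have ne: "2 * p \<noteq> 2 * p + 1" "2 * p + 1 \<noteq> 2 * p" by presburger+
  have lt: "(0::nat) < 1" "(0::nat) < 2" "(0::nat) < 3" "(1::nat) < 2" "(1::nat) < 3" "(2::nat) < 3"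
    "\<not> (0::nat) < 0" "\<not> (1::nat) < 0" "\<not> (2::nat) < 0" "\<not> (3::nat) < 0"
    "\<not> (1::nat) < 1" "\<not> (2::nat) < 1" "\<not> (3::nat) < 1"
    "\<not> (2::nat) < 2" "\<not> (3::nat) < 2" "\<not> (3::nat) < 3"
    by simp_all
  note cc = contract_create[of "2 * p" "2 * p"] contract_create[of "2 * p" "2 * p + 1"]
    contract_create[of "2 * p + 1" "2 * p"] contract_create[of "2 * p + 1" "2 * p + 1"]
  show ?thesis
    using assms ne unfolding sum_upto_four lt if_True if_False clifford_term_def
    apply (simp only: clifford_four[unfolded One_nat_def] add_0_right add_0_left finitary_closed One_nat_def simp_thms)
    apply (simp only: create_linear contract_linear)
    \<comment> \<open>only now evaluate at \<open>S\<close>, where the anticommutation relations apply\<close>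
    apply (simp only: plus_fun_apply fun_diff_def mv_scale_def cc[unfolded One_nat_def] One_nat_def
      if_False if_True simp_thms create_create_same contract_contract_same)
    apply (simp add: quat_simps)
    apply (simp add: field_simps)
    done
qed

section \<open>The isotropy representation in the given basis\<close>

lemma quat_sel [simp]:
  "qRe 0 = 0" "qI 0 = 0" "qJ 0 = 0" "qK 0 = 0"
  "qRe 1 = 1" "qI 1 = 0" "qJ 1 = 0" "qK 1 = 0"
  "qRe (x + y) = qRe x + qRe y" "qI (x + y) = qI x + qI y"
  "qJ (x + y) = qJ x + qJ y" "qK (x + y) = qK x + qK y"
  "qRe (x - y) = qRe x - qRe y" "qI (x - y) = qI x - qI y"
  "qJ (x - y) = qJ x - qJ y" "qK (x - y) = qK x - qK y"
  "qRe (- x) = - qRe x" "qI (- x) = - qI x" "qJ (- x) = - qJ x" "qK (- x) = - qK x"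
  "qRe (x * y) = qRe x * qRe y - qI x * qI y - qJ x * qJ y - qK x * qK y"
  "qI (x * y) = qRe x * qI y + qI x * qRe y + qJ x * qK y - qK x * qJ y"
  "qJ (x * y) = qRe x * qJ y - qI x * qK y + qJ x * qRe y + qK x * qI y"
  "qK (x * y) = qRe x * qK y + qI x * qJ y - qJ x * qI y + qK x * qRe y"
  "qRe (of_real c) = c" "qI (of_real c) = 0" "qJ (of_real c) = 0" "qK (of_real c) = 0"
  "qRe (quat_cnj x) = qRe x" "qI (quat_cnj x) = - qI x"
  "qJ (quat_cnj x) = - qJ x" "qK (quat_cnj x) = - qK x"
  "qRe quat_i = 0" "qI quat_i = 1" "qJ quat_i = 0" "qK quat_i = 0"
  "qRe quat_j = 0" "qI quat_j = 0" "qJ quat_j = 1" "qK quat_j = 0"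
  "qRe quat_k = 0" "qI quat_k = 0" "qJ quat_k = 0" "qK quat_k = 1"
  by (simp_all add: zero_quat_def one_quat_def plus_quat_def minus_quat_def uminus_quat_def times_quat_def
    of_real_def scaleR_quat_def quat_cnj_def quat_i_def quat_j_def quat_k_def)

lemma quat_eq_iff: "x = y \<longleftrightarrow> qRe x = qRe y \<and> qI x = qI y \<and> qJ x = qJ y \<and> qK x = qK y"
  by (auto intro: quat.expand)

lemma qRe_sum: "qRe (\<Sum>i\<in>A. f i) = (\<Sum>i\<in>A. qRe (f i))"
  by (induction A rule: infinite_finite_induct) auto

lemma quat_cnj_simps:
  "quat_cnj (x + y) = quat_cnj x + quat_cnj y" "quat_cnj (x * y) = quat_cnj y * quat_cnj x"
  "quat_cnj 0 = 0" "quat_cnj (- x) = - quat_cnj x" "quat_cnj (quat_cnj x) = x"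
  by (simp_all add: quat_eq_iff algebra_simps)

lemma quat_cnj_sum: "quat_cnj (\<Sum>i\<in>A. f i) = (\<Sum>i\<in>A. quat_cnj (f i))"
  by (induction A rule: infinite_finite_induct) (auto simp: quat_cnj_simps)

lemma qdot_scale: "qdot (x * (of_real c * y)) (of_real c * z) = c * c * qdot (x * y) z"
  by (simp add: qdot_def algebra_simps)

lemma h_alg_iff:
  assumes "n \<ge> 1"
  shows "h \<in> h_alg n \<longleftrightarrow> h \<in> carrier_mat n n \<and> (\<forall>r<n. h $$ (r, 0) = 0 \<and> h $$ (0, r) = 0) \<and>
    (\<forall>r<n. \<forall>s<n. quat_cnj (h $$ (s, r)) = - h $$ (r, s))" (is "_ \<longleftrightarrow> ?R h")
proof
  assume "h \<in> h_alg n"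
  then obtain Y where Y: "Y \<in> sp_alg (n - 1)"
    and h: "h = four_block_mat (0\<^sub>m 1 1) (0\<^sub>m 1 (n - 1)) (0\<^sub>m (n - 1) 1) Y"
    by (auto simp: h_alg_def)
  have c: "Y \<in> carrier_mat (n - 1) (n - 1)" and adj: "quat_adjoint Y = - Y"
    using Y by (auto simp: sp_alg_def)
  have Y': "quat_cnj (Y $$ (s, r)) = - Y $$ (r, s)" if "r < n - 1" "s < n - 1" for r s
    using arg_cong[OF adj, of "\<lambda>M. M $$ (r, s)"] c that by (simp add: quat_adjoint_def)
  have "h \<in> carrier_mat n n" unfolding h using c assms by auto
  moreover have "h $$ (r, 0) = 0 \<and> h $$ (0, r) = 0" if "r < n" for r
    unfolding h using c assms that by auto
  moreover have "quat_cnj (h $$ (s, r)) = - h $$ (r, s)" if "r < n" "s < n" for r s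
    unfolding h using c assms that Y'[of "r - 1" "s - 1"] by (auto simp: quat_cnj_simps)
  ultimately show "?R h" by blast
next
  assume R: "?R h"
  define Y where "Y = mat (n - 1) (n - 1) (\<lambda>(r, s). h $$ (Suc r, Suc s))"
  have "quat_adjoint Y = - Y"
    using R by (intro eq_matI) (auto simp: quat_adjoint_def Y_def)
  then have "Y \<in> sp_alg (n - 1)" by (auto simp: sp_alg_def Y_def)
  moreover have "h = four_block_mat (0\<^sub>m 1 1) (0\<^sub>m 1 (n - 1)) (0\<^sub>m (n - 1) 1) Y"
    using R assms by (intro eq_matI) (auto simp: Y_def)
  ultimately show "h \<in> h_alg n" by (auto simp: h_alg_def)
qed

text \<open>
  The element of the summand \<open>m_4\<close> whose first column is \<open>v\<close> below the corner.  The entry \<open>v 0\<close> is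
  irrelevant.
\<close>

definition tangent_mat :: "nat \<Rightarrow> (nat \<Rightarrow> quat) \<Rightarrow> quat mat" where
  "tangent_mat n v = mat n n (\<lambda>(r, s). if r = 0 \<and> s \<noteq> 0 then - quat_cnj (v s)
     else if r \<noteq> 0 \<and> s = 0 then v r else 0)"

lemma tangent_mat_carrier [simp]: "tangent_mat n v \<in> carrier_mat n n"
  by (simp add: tangent_mat_def)

lemma mat_mult_entry:
  assumes "A \<in> carrier_mat n n" "B \<in> carrier_mat n n" "r < n" "s < n"
  shows "(A * B) $$ (r, s) = (\<Sum>t<n. A $$ (r, t) * B $$ (t, s))"
  using assms by (simp add: times_mat_def scalar_prod_def lessThan_atLeast0)

lemma quat_trace_mult:
  assumes "A \<in> carrier_mat n n" "B \<in> carrier_mat n n"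
  shows "quat_trace (A * B) = (\<Sum>r<n. \<Sum>s<n. A $$ (r, s) * B $$ (s, r))"
  using assms by (auto simp: quat_trace_def scalar_prod_def lessThan_atLeast0 intro!: sum.cong)

lemma B0_zero:
  assumes "X \<in> carrier_mat n n"
  shows "B0 (0\<^sub>m n n) X = 0" "B0 X (0\<^sub>m n n) = 0"
  using assms by (simp_all add: B0_def quat_trace_def)

lemma sum_row_zero_split:
  fixes f :: "nat \<Rightarrow> nat \<Rightarrow> quat"
  assumes "n \<ge> 1" "\<And>r s. r \<noteq> 0 \<Longrightarrow> s \<noteq> 0 \<Longrightarrow> f r s = 0" "f 0 0 = 0"
  shows "(\<Sum>r<n. \<Sum>s<n. f r s) = (\<Sum>s\<in>{1..<n}. f 0 s) + (\<Sum>r\<in>{1..<n}. f r 0)"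
proof -
  have I: "{..<n} = insert 0 {1..<n}" using assms(1) by auto
  have "(\<Sum>r\<in>{1..<n}. \<Sum>s<n. f r s) = (\<Sum>r\<in>{1..<n}. f r 0)"
    unfolding I by (intro sum.cong refl) (simp add: assms)
  then show ?thesis unfolding I by (simp add: assms)
qed

lemma B0_tangent_mat:
  assumes "n \<ge> 1"
  shows "B0 (tangent_mat n v) (tangent_mat n w) = 2 * (\<Sum>r\<in>{1..<n}. qdot (v r) (w r))"
proof -
  let ?f = "\<lambda>r s. if r = 0 \<and> s \<noteq> 0 then - quat_cnj (v s) * w s
    else if r \<noteq> 0 \<and> s = 0 then - v r * quat_cnj (w r) else 0"
  have "quat_trace (tangent_mat n v * tangent_mat n w) = (\<Sum>r<n. \<Sum>s<n. ?f r s)"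
    by (subst quat_trace_mult[of _ n]) (auto simp: tangent_mat_def intro!: sum.cong)
  also have "\<dots> = (\<Sum>s\<in>{1..<n}. ?f 0 s) + (\<Sum>r\<in>{1..<n}. ?f r 0)"
    by (rule sum_row_zero_split) (use assms in auto)
  finally show ?thesis
    by (simp add: B0_def qRe_sum sum_distrib_left sum.distrib[symmetric] sum_negf[symmetric]
      qdot_def algebra_simps cong: sum.cong_simp)
qed

text \<open>
  The isotropy algebra acts on first columns by left multiplication.  The first row follows because \<open>h\<close>
  is skew-adjoint.
\<close>

lemma bracket_tangent_mat:
  assumes n: "n \<ge> 1" and h: "h \<in> h_alg n"
  shows "h * tangent_mat n v - tangent_mat n v * h =
    tangent_mat n (\<lambda>r. \<Sum>s<n. h $$ (r, s) * v s)"
proof -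
  let ?X = "tangent_mat n v"
  have hc: "h \<in> carrier_mat n n" and h0: "\<And>r. r < n \<Longrightarrow> h $$ (r, 0) = 0" "\<And>r. r < n \<Longrightarrow> h $$ (0, r) = 0"
    and hs: "\<And>r s. r < n \<Longrightarrow> s < n \<Longrightarrow> quat_cnj (h $$ (s, r)) = - h $$ (r, s)"
    using h unfolding h_alg_iff[OF n] by auto
  show ?thesis
  proof (rule eq_matI)
    fix r s assume "r < dim_row (tangent_mat n (\<lambda>r. \<Sum>s<n. h $$ (r, s) * v s))"
      "s < dim_col (tangent_mat n (\<lambda>r. \<Sum>s<n. h $$ (r, s) * v s))"
    then have r: "r < n" and s: "s < n" by (auto simp: tangent_mat_def)
    have "(h * ?X - ?X * h) $$ (r, s) = (h * ?X) $$ (r, s) - (?X * h) $$ (r, s)"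
      using hc r s by (intro index_minus_mat) (auto simp: tangent_mat_def)
    also have "(h * ?X) $$ (r, s) = (if s = 0 then \<Sum>t<n. h $$ (r, t) * v t else 0)"
    proof -
      have "(h * ?X) $$ (r, s) = (\<Sum>t<n. h $$ (r, t) * ?X $$ (t, s))"
        by (rule mat_mult_entry[OF hc _ r s]) simp
      also have "\<dots> = (\<Sum>t<n. if s = 0 then h $$ (r, t) * v t else 0)"
        by (intro sum.cong refl) (use r s h0 in \<open>auto simp: tangent_mat_def\<close>)
      finally show ?thesis by simp
    qed
    also have "(?X * h) $$ (r, s) = (if r = 0 then quat_cnj (\<Sum>t<n. h $$ (s, t) * v t) else 0)"
    proof -
      have "(?X * h) $$ (r, s) = (\<Sum>t<n. ?X $$ (r, t) * h $$ (t, s))"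
        by (rule mat_mult_entry[OF _ hc r s]) simp
      also have "\<dots> = (\<Sum>t<n. if r = 0 then quat_cnj (h $$ (s, t) * v t) else 0)"
        by (intro sum.cong refl) (use r s h0 hs in \<open>auto simp: tangent_mat_def quat_cnj_simps\<close>)
      finally show ?thesis by (simp add: quat_cnj_sum)
    qed
    finally show "(h * ?X - ?X * h) $$ (r, s) = tangent_mat n (\<lambda>r. \<Sum>s<n. h $$ (r, s) * v s) $$ (r, s)"
      using r s h0 by (auto simp: tangent_mat_def quat_cnj_simps)
  qed (use hc in \<open>auto simp: tangent_mat_def\<close>)
qed

lemma real_span_scaled: "X \<in> S \<Longrightarrow> X \<in> carrier_mat n n \<Longrightarrow> of_real c \<cdot>\<^sub>m X \<in> real_span n S"
  using real_span.step[OF _ real_span.zero, where c = c and X = X and S = S and n = n]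
  by (metis right_add_zero_mat smult_carrier_mat)

lemma real_span_singleton:
  assumes "Y \<in> real_span n {X}" "X \<in> carrier_mat n n"
  obtains c where "Y = of_real c \<cdot>\<^sub>m X"
proof -
  have "\<exists>c. Y = of_real c \<cdot>\<^sub>m X"
    using assms(1)
  proof induction
    case zero
    show ?case by (intro exI[of _ 0] eq_matI) (use assms(2) in auto)
  next
    case (step Z Y c)
    then obtain d where "Y = of_real d \<cdot>\<^sub>m X" by blast
    then show ?case using step
      by (intro exI[of _ "c + d"]) (simp add: add_smult_distrib_right_mat[OF assms(2)])
  qed
  then show ?thesis using that by blast
qed

text \<open>
  The elements of \<open>m_1\<close>, \<open>m_2\<close> and \<open>m_3\<close> are of this form.
\<close>

definition corner_mat :: "nat \<Rightarrow> quat \<Rightarrow> quat mat" where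
  "corner_mat n x = mat n n (\<lambda>(r, s). if r = 0 \<and> s = 0 then x else 0)"

lemma corner_mat_carrier [simp]: "corner_mat n x \<in> carrier_mat n n"
  by (simp add: corner_mat_def)

lemma smult_F_mat: "x \<cdot>\<^sub>m F_mat n 1 1 = corner_mat n x"
  by (rule eq_matI) (auto simp: F_mat_def corner_mat_def)

lemma smult_corner_mat: "c \<cdot>\<^sub>m corner_mat n x = corner_mat n (c * x)"
  by (rule eq_matI) (auto simp: corner_mat_def)

lemma real_span_corner_zero:
  assumes "Y \<in> real_span n S" "\<And>X. X \<in> S \<Longrightarrow> X \<in> carrier_mat n n \<and> X $$ (0, 0) = 0" "n \<ge> 1"
  shows "Y \<in> carrier_mat n n \<and> Y $$ (0, 0) = 0"
  using assms(1)
proof induction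
  case zero
  show ?case using assms(3) by auto
next
  case (step X Y c)
  then show ?case using assms(2)[of X] assms(3) by auto
qed

lemma m_summand_corner:
  assumes "n \<ge> 1"
  shows "Y \<in> m_summand n 1 \<Longrightarrow> \<exists>c. Y = corner_mat n (of_real c * quat_i)"
    "Y \<in> m_summand n 2 \<Longrightarrow> \<exists>c. Y = corner_mat n (of_real c * quat_k)"
    "Y \<in> m_summand n 3 \<Longrightarrow> \<exists>c. Y = corner_mat n (of_real c * quat_j)"
    "Y \<in> m_summand n 4 \<Longrightarrow> Y \<in> carrier_mat n n \<and> Y $$ (0, 0) = 0"
proof -
  show "Y \<in> m_summand n 1 \<Longrightarrow> \<exists>c. Y = corner_mat n (of_real c * quat_i)"
    "Y \<in> m_summand n 2 \<Longrightarrow> \<exists>c. Y = corner_mat n (of_real c * quat_k)"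
    "Y \<in> m_summand n 3 \<Longrightarrow> \<exists>c. Y = corner_mat n (of_real c * quat_j)"
    unfolding m_summand_def smult_F_mat
    by (simp_all, (metis corner_mat_carrier real_span_singleton smult_corner_mat)+)
  assume "Y \<in> m_summand n 4"
  then have "Y \<in> real_span n (\<Union>p \<in> {2..n}.
        {quat_i \<cdot>\<^sub>m F_mat n 1 p, quat_j \<cdot>\<^sub>m F_mat n 1 p, quat_k \<cdot>\<^sub>m F_mat n 1 p, E_mat n 1 p})"
    by (simp add: m_summand_def)
  then show "Y \<in> carrier_mat n n \<and> Y $$ (0, 0) = 0"
    by (rule real_span_corner_zero) (use assms in \<open>auto simp: F_mat_def E_mat_def\<close>)
qed

lemma m_summand_carrier:
  assumes "n \<ge> 1" "Y \<in> m_summand n r" "r \<in> {1..4}"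
  shows "Y \<in> carrier_mat n n"
proof -
  have "r = 1 \<or> r = 2 \<or> r = 3 \<or> r = 4" using assms(3) by auto
  then show ?thesis
    using assms(2) m_summand_corner[OF assms(1), of Y] corner_mat_carrier by metis
qed

text \<open>
  The corner entry of the sum has the first three components as its \<open>i\<close>-, \<open>k\<close>- and \<open>j\<close>-parts, as the
  fourth one vanishes there; it determines them, and then the fourth one by subtraction.
\<close>

lemma m_summands_independent:
  assumes n: "n \<ge> 1" and Y: "\<forall>s \<in> {1..4}. Y s \<in> m_summand n s"
    and Z: "\<forall>s \<in> {1..4}. Z s \<in> m_summand n s"
    and eq: "Y 1 + Y 2 + Y 3 + Y 4 = Z 1 + Z 2 + Z 3 + (Z 4 :: quat mat)"
    and r: "r \<in> {1..4}"
  shows "Y r = Z r"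
proof -
  have "Y 1 \<in> m_summand n 1" "Y 2 \<in> m_summand n 2" "Y 3 \<in> m_summand n 3" and Y4: "Y 4 \<in> m_summand n 4"
   and "Z 1 \<in> m_summand n 1" "Z 2 \<in> m_summand n 2" "Z 3 \<in> m_summand n 3" and Z4: "Z 4 \<in> m_summand n 4"
    using Y Z by auto
  then obtain c1 c2 c3 d1 d2 d3 where
    Y123: "Y 1 = corner_mat n (of_real c1 * quat_i)" "Y 2 = corner_mat n (of_real c2 * quat_k)"
      "Y 3 = corner_mat n (of_real c3 * quat_j)" and
    Z123: "Z 1 = corner_mat n (of_real d1 * quat_i)" "Z 2 = corner_mat n (of_real d2 * quat_k)"
      "Z 3 = corner_mat n (of_real d3 * quat_j)"
    using m_summand_corner[OF n] by metis
  note Y4 = m_summand_corner(4)[OF n Y4] and Z4 = m_summand_corner(4)[OF n Z4]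
  have entry: "(Y 1 + Y 2 + Y 3 + Y 4) $$ (i, j) = (Z 1 + Z 2 + Z 3 + Z 4) $$ (i, j)" for i j
    using eq by (simp only:)
  have sum_entry: "(A + B + C + D) $$ (i, j) = A $$ (i, j) + B $$ (i, j) + C $$ (i, j) + D $$ (i, j)"
    if "B \<in> carrier_mat n n" "C \<in> carrier_mat n n" "D \<in> carrier_mat n n" "i < n" "j < n"
    for A B C D :: "quat mat" and i j
    using that by auto
  have "(Y 1 + Y 2 + Y 3 + Y 4) $$ (0, 0) = Quat 0 c1 c3 c2"
    using n Y4 unfolding Y123 by (subst sum_entry) (auto simp: corner_mat_def quat_eq_iff)
  moreover have "(Z 1 + Z 2 + Z 3 + Z 4) $$ (0, 0) = Quat 0 d1 d3 d2"
    using n Z4 unfolding Z123 by (subst sum_entry) (auto simp: corner_mat_def quat_eq_iff)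
  ultimately have "c1 = d1 \<and> c2 = d2 \<and> c3 = d3"
    using entry[of 0 0] by simp
  then have 123: "Y 1 = Z 1" "Y 2 = Z 2" "Y 3 = Z 3" using Y123 Z123 by auto
  have "Y 4 = Z 4"
  proof (rule eq_matI)
    fix i j assume "i < dim_row (Z 4)" "j < dim_col (Z 4)"
    then show "Y 4 $$ (i, j) = Z 4 $$ (i, j)"
      using entry[of i j] Y4 Z4 unfolding 123 Z123 by (subst (asm) (1 2) sum_entry) auto
  qed (use Y4 Z4 in auto)
  moreover have "r = 1 \<or> r = 2 \<or> r = 3 \<or> r = 4" using r by auto
  ultimately show ?thesis using 123 by auto
qed

lemma zero_in_m_summand: "0\<^sub>m n n \<in> m_summand n r"
  by (simp add: m_summand_def real_span.zero)

lemma m_component_summand: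
  assumes n: "n \<ge> 1" and X: "X \<in> m_summand n r0" and r0: "r0 \<in> {1..4}" and r: "r \<in> {1..4}"
  shows "m_component n r X = (if r = r0 then X else 0\<^sub>m n n)"
proof -
  have Xc: "X \<in> carrier_mat n n" by (rule m_summand_carrier[OF n X r0])
  define Y where "Y s = (if s = r0 then X else 0\<^sub>m n n)" for s
  have Y: "\<forall>s \<in> {1..4}. Y s \<in> m_summand n s"
    using X by (auto simp: Y_def zero_in_m_summand)
  have "r0 = 1 \<or> r0 = 2 \<or> r0 = 3 \<or> r0 = 4" using r0 by auto
  then have sum: "X = Y 1 + Y 2 + Y 3 + Y 4"
    using Xc by (elim disjE) (simp_all add: Y_def)
  have "m_component n r X = Y r"
    unfolding m_component_def
  proof (rule the_equality)
    show "\<exists>Y'. (\<forall>s \<in> {1..4}. Y' s \<in> m_summand n s) \<and>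
       X = Y' 1 + Y' 2 + Y' 3 + Y' 4 \<and> Y r = Y' r"
      using Y sum by blast
  next
    fix Z assume "\<exists>Y'. (\<forall>s \<in> {1..4}. Y' s \<in> m_summand n s) \<and>
       X = Y' 1 + Y' 2 + Y' 3 + Y' 4 \<and> Z = Y' r"
    then obtain Y' where Y': "\<forall>s \<in> {1..4}. Y' s \<in> m_summand n s"
      "X = Y' 1 + Y' 2 + Y' 3 + Y' 4" "Z = Y' r" by blast
    then show "Z = Y r"
      using m_summands_independent[OF n Y'(1) Y _ r] sum by simp
  qed
  then show ?thesis by (simp add: Y_def)
qed

text \<open>
  The entries of \<open>v\<close> are built up one at a time, each from its four real parts.
\<close>

lemma tangent_mat_in_summand:
  assumes "n \<ge> 1"
  shows "tangent_mat n v \<in> m_summand n 4"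
proof -
  let ?S = "\<Union>p \<in> {2..n}.
        {quat_i \<cdot>\<^sub>m F_mat n 1 p, quat_j \<cdot>\<^sub>m F_mat n 1 p, quat_k \<cdot>\<^sub>m F_mat n 1 p, E_mat n 1 p}"
  have "k \<le> n \<Longrightarrow> tangent_mat n (\<lambda>r. if r < k then v r else 0) \<in> real_span n ?S" for k
  proof (induction k)
    case 0
    have "tangent_mat n (\<lambda>r. if r < 0 then v r else 0) = 0\<^sub>m n n"
      by (rule eq_matI) (auto simp: tangent_mat_def quat_cnj_simps)
    then show ?case by (simp only: real_span.zero)
  next
    case (Suc k)
    let ?V = "tangent_mat n (\<lambda>r. if r < k then v r else 0)"
    have V: "?V \<in> real_span n ?S" using Suc by simp
    show ?case
    proof (cases "k = 0")
      case True
      have "tangent_mat n (\<lambda>r. if r < Suc k then v r else 0) = ?V"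
        by (rule eq_matI) (auto simp: tangent_mat_def True quat_cnj_simps)
      then show ?thesis using V by simp
    next
      case False
      let ?p = "k + 1"
      have p: "?p \<in> {2..n}" using False Suc by auto
      have "of_real (qI (v k)) \<cdot>\<^sub>m (quat_i \<cdot>\<^sub>m F_mat n 1 ?p) +
         (of_real (qJ (v k)) \<cdot>\<^sub>m (quat_j \<cdot>\<^sub>m F_mat n 1 ?p) +
         (of_real (qK (v k)) \<cdot>\<^sub>m (quat_k \<cdot>\<^sub>m F_mat n 1 ?p) +
         (of_real (qRe (v k)) \<cdot>\<^sub>m E_mat n 1 ?p + ?V))) \<in> real_span n ?S"
        by (intro real_span.step V) (use p in blast)+
      moreover have "tangent_mat n (\<lambda>r. if r < Suc k then v r else 0) =
         of_real (qI (v k)) \<cdot>\<^sub>m (quat_i \<cdot>\<^sub>m F_mat n 1 ?p) +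
         (of_real (qJ (v k)) \<cdot>\<^sub>m (quat_j \<cdot>\<^sub>m F_mat n 1 ?p) +
         (of_real (qK (v k)) \<cdot>\<^sub>m (quat_k \<cdot>\<^sub>m F_mat n 1 ?p) +
         (of_real (qRe (v k)) \<cdot>\<^sub>m E_mat n 1 ?p + ?V)))"
        using False
        by (intro eq_matI) (auto simp: tangent_mat_def F_mat_def E_mat_def quat_eq_iff less_Suc_eq)
      ultimately show ?thesis by simp
    qed
  qed
  from this[of n] have "tangent_mat n (\<lambda>r. if r < n then v r else 0) \<in> real_span n ?S" by simp
  moreover have "tangent_mat n (\<lambda>r. if r < n then v r else 0) = tangent_mat n v"
    by (rule eq_matI) (auto simp: tangent_mat_def)
  ultimately show ?thesis by (simp add: m_summand_def)
qed

lemma m_spaceI: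
  assumes n: "n \<ge> 1" and X: "X \<in> carrier_mat n n"
    and skew: "\<And>r s. r < n \<Longrightarrow> s < n \<Longrightarrow> quat_cnj (X $$ (s, r)) = - X $$ (r, s)"
    and block: "\<And>r s. r < n \<Longrightarrow> s < n \<Longrightarrow> r \<noteq> 0 \<Longrightarrow> s \<noteq> 0 \<Longrightarrow> X $$ (r, s) = 0"
  shows "X \<in> m_space n"
proof -
  have "quat_adjoint X = - X"
    using X skew by (intro eq_matI) (auto simp: quat_adjoint_def)
  moreover have "B0 X h = 0" if "h \<in> h_alg n" for h
  proof -
    have h: "h \<in> carrier_mat n n" "\<And>r. r < n \<Longrightarrow> h $$ (r, 0) = 0 \<and> h $$ (0, r) = 0"
      using that unfolding h_alg_iff[OF n] by auto
    have "X $$ (r, s) * h $$ (s, r) = 0" if "r < n" "s < n" for r s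
      using h(2) block that by (cases "r = 0 \<or> s = 0") auto
    then show ?thesis by (simp add: B0_def quat_trace_mult[OF X h(1)])
  qed
  ultimately show ?thesis using X by (simp add: m_space_def sp_alg_def)
qed

lemma tangent_mat_m_space: "n \<ge> 1 \<Longrightarrow> tangent_mat n v \<in> m_space n"
  by (rule m_spaceI) (auto simp: tangent_mat_def quat_cnj_simps)

lemma corner_m_space:
  assumes "n \<ge> 1" "qRe x = 0"
  shows "corner_mat n x \<in> m_space n"
  by (rule m_spaceI) (use assms in \<open>auto simp: corner_mat_def quat_eq_iff\<close>)

lemma e_vec_tangent_mat:
  assumes "p \<noteq> 0" "s < 4"
  shows "e_vec n a (4 * p + s) =
    tangent_mat n (\<lambda>r. if r = p then of_real (1 / sqrt (2 * a 4)) * quat_unit s else 0)"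
proof -
  have d: "(4 * p + s) div 4 = p" "(4 * p + s) mod 4 = s" using assms(2) by auto
  have ne: "4 * p + s \<noteq> 1" "4 * p + s \<noteq> 2" "4 * p + s \<noteq> 3" using assms(1) by auto
  have "s = 0 \<or> s = 1 \<or> s = 2 \<or> s = 3" using assms(2) by auto
  then show ?thesis
    unfolding e_vec_def if_not_P[OF ne(1)] if_not_P[OF ne(2)] if_not_P[OF ne(3)] Let_def d
    using assms(1)
    by (elim disjE; intro eq_matI)
      (auto simp: tangent_mat_def F_mat_def E_mat_def quat_eq_iff quat_unit_def)
qed

lemma e_vec_corner:
  assumes "l \<in> {1, 2, 3}"
  shows "\<exists>x. qRe x = 0 \<and> e_vec n a l = corner_mat n x" "e_vec n a l \<in> m_summand n l"
proof -
  have e: "e_vec n a 1 = corner_mat n (of_real (1 / sqrt (a 1)) * quat_i)"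
    "e_vec n a 2 = corner_mat n (of_real (- (1 / sqrt (a 2))) * quat_k)"
    "e_vec n a 3 = corner_mat n (of_real (1 / sqrt (a 3)) * quat_j)"
    unfolding e_vec_def smult_F_mat smult_corner_mat by simp_all
  show "\<exists>x. qRe x = 0 \<and> e_vec n a l = corner_mat n x"
    using assms e by (elim insertE emptyE; intro exI conjI) (auto simp only:, simp_all)
  have "corner_mat n (of_real c * x) \<in> real_span n {corner_mat n x}" for c x
    unfolding smult_corner_mat[symmetric] by (rule real_span_scaled) auto
  from this[of "1 / sqrt (a 1)" quat_i] this[of "- (1 / sqrt (a 2))" quat_k]
    this[of "1 / sqrt (a 3)" quat_j]
  have "e_vec n a 1 \<in> m_summand n 1" "e_vec n a 2 \<in> m_summand n 2" "e_vec n a 3 \<in> m_summand n 3"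
    unfolding e m_summand_def smult_F_mat by simp_all
  then show "e_vec n a l \<in> m_summand n l" using assms by blast
qed

lemma metric_m4:
  assumes n: "n \<ge> 1" and X: "X \<in> m_summand n 4" and Y: "Y \<in> m_summand n r0" and r0: "r0 \<in> {1..4}"
  shows "metric n a X Y = (if r0 = 4 then a 4 * B0 X Y else 0)"
proof -
  have c: "X \<in> carrier_mat n n" "Y \<in> carrier_mat n n"
    using m_summand_carrier[OF n X] m_summand_carrier[OF n Y r0] by auto
  have "metric n a X Y = (\<Sum>r = 1..(4::nat). if r = 4 then (if r0 = 4 then a 4 * B0 X Y else 0) else 0)"
    unfolding metric_def
    by (intro sum.cong refl)
      (use m_component_summand[OF n X] m_component_summand[OF n Y r0] c in \<open>auto simp: B0_zero\<close>)
  then show ?thesis by simp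
qed

text \<open>
  The metric parameters disappear: \<open>h\<close> acts trivially on the corner, and on \<open>m_4\<close> the factor
  \<open>a 4 * 2\<close> of the metric, with the 2 coming from first row and first column, cancels against the
  normalisation \<open>1 / sqrt (2 * a 4)\<close> of the two basis vectors.  For \<open>p = 0\<close> or \<open>q = 0\<close>, that is for one
  of the first three basis vectors, the right-hand side vanishes because \<open>h\<close> has zero first row and
  column.
\<close>

lemma isotropy_coefficient:
  assumes n: "n \<ge> 1" and a: "a 4 > 0" and h: "h \<in> h_alg n"
    and p: "p < n" and q: "q < n" and s: "s < 4" and t: "t < 4"
    and pos: "4 * p + s \<noteq> 0" "4 * q + t \<noteq> 0"
  shows "metric n a (ad_m n h (e_vec n a (4 * p + s))) (e_vec n a (4 * q + t)) =
    qdot (h $$ (q, p) * quat_unit s) (quat_unit t)"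
proof -
  let ?c = "1 / sqrt (2 * a 4)"
  let ?i = "4 * p + s" and ?j = "4 * q + t"
  have h0: "h \<in> carrier_mat n n" "\<And>r. r < n \<Longrightarrow> h $$ (r, 0) = 0" "\<And>r. r < n \<Longrightarrow> h $$ (0, r) = 0"
    using h unfolding h_alg_iff[OF n] by auto
  define w where "w r = h $$ (r, p) * (of_real ?c * quat_unit s)" for r
  have ad: "ad_m n h (e_vec n a ?i) = tangent_mat n w"
  proof (cases "p = 0")
    case True
    then have "?i \<in> {1, 2, 3}" using s pos by auto
    then obtain x where x: "qRe x = 0" and e: "e_vec n a ?i = corner_mat n x"
      using e_vec_corner(1) by blast
    have c: "corner_mat n x \<in> carrier_mat n n" by simp
    have "ad_m n h (e_vec n a ?i) = h * corner_mat n x - corner_mat n x * h"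
      unfolding ad_m_def e using corner_m_space[OF n x] by simp
    also have "\<dots> = tangent_mat n w"
    proof (rule eq_matI)
      fix r s' assume "r < dim_row (tangent_mat n w)" "s' < dim_col (tangent_mat n w)"
      then have r: "r < n" and s': "s' < n" by (auto simp: tangent_mat_def)
      have "(h * corner_mat n x) $$ (r, s') = 0"
        unfolding mat_mult_entry[OF h0(1) c r s']
        by (intro sum.neutral ballI) (use r s' h0 in \<open>auto simp: corner_mat_def\<close>)
      moreover have "(corner_mat n x * h) $$ (r, s') = 0"
        unfolding mat_mult_entry[OF c h0(1) r s']
        by (intro sum.neutral ballI) (use r s' h0 in \<open>auto simp: corner_mat_def\<close>)
      moreover have "(h * corner_mat n x - corner_mat n x * h) $$ (r, s') =
         (h * corner_mat n x) $$ (r, s') - (corner_mat n x * h) $$ (r, s')"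
        using h0(1) carrier_matD[OF c] r s' by (intro index_minus_mat) auto
      moreover have "w k = 0" if "k < n" for k using that h0 True by (simp add: w_def)
      ultimately show "(h * corner_mat n x - corner_mat n x * h) $$ (r, s') =
          tangent_mat n w $$ (r, s')"
        using r s' by (auto simp: tangent_mat_def quat_cnj_simps)
    qed (use h0 carrier_matD[OF c] in \<open>auto simp: tangent_mat_def\<close>)
    finally show ?thesis .
  next
    case False
    let ?v = "\<lambda>r. if r = p then of_real ?c * quat_unit s else 0"
    have "ad_m n h (e_vec n a ?i) = h * tangent_mat n ?v - tangent_mat n ?v * h"
      unfolding ad_m_def e_vec_tangent_mat[OF False s] using tangent_mat_m_space[OF n] by simp
    also have "\<dots> = tangent_mat n (\<lambda>r. \<Sum>s<n. h $$ (r, s) * ?v s)"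
      by (rule bracket_tangent_mat[OF n h])
    also have "(\<lambda>r. \<Sum>s<n. h $$ (r, s) * ?v s) = w"
      using p by (auto simp: w_def if_distrib[of "\<lambda>x. _ * x"] cong: if_cong)
    finally show ?thesis .
  qed
  have X: "tangent_mat n w \<in> m_summand n 4" by (rule tangent_mat_in_summand[OF n])
  show ?thesis
  proof (cases "q = 0")
    case True
    then have j: "?j \<in> {1, 2, 3}" using t pos by auto
    then have "metric n a (tangent_mat n w) (e_vec n a ?j) = 0"
      using metric_m4[OF n X e_vec_corner(2)[OF j]] by auto
    then show ?thesis unfolding ad using True h0 p by (simp add: qdot_def)
  next
    case False
    let ?v = "\<lambda>r. if r = q then of_real ?c * quat_unit t else 0"
    have cc: "?c * ?c = 1 / (2 * a 4)" using a by simp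
    have "metric n a (tangent_mat n w) (tangent_mat n ?v) = a 4 * B0 (tangent_mat n w) (tangent_mat n ?v)"
      using metric_m4[OF n X tangent_mat_in_summand[OF n]] by simp
    also have "B0 (tangent_mat n w) (tangent_mat n ?v) = 2 * qdot (w q) (of_real ?c * quat_unit t)"
    proof -
      have "(\<Sum>r\<in>{1..<n}. qdot (w r) (?v r)) =
         (\<Sum>r\<in>{1..<n}. if r = q then qdot (w r) (of_real ?c * quat_unit t) else 0)"
        by (intro sum.cong) (auto simp: qdot_def)
      also have "\<dots> = qdot (w q) (of_real ?c * quat_unit t)"
        using q False by (subst sum.delta) auto
      finally show ?thesis unfolding B0_tangent_mat[OF n] by simp
    qed
    also have "qdot (w q) (of_real ?c * quat_unit t) =
      ?c * ?c * qdot (h $$ (q, p) * quat_unit s) (quat_unit t)"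
      unfolding w_def by (rule qdot_scale)
    finally show ?thesis unfolding ad e_vec_tangent_mat[OF False t] cc using a by simp
  qed
qed

section \<open>The spin lift and its kernel\<close>

definition spin_block :: "quat mat \<Rightarrow> multivector \<Rightarrow> nat \<Rightarrow> nat \<Rightarrow> multivector" where
  "spin_block h \<eta> p q = (\<Sum>s<4. \<Sum>t<4.
     if 4 * p + s < 4 * q + t then clifford_term p q (h $$ (q, p)) s t \<eta> else 0)"

lemma sum_four_blocks:
  fixes f :: "nat \<Rightarrow> 'a::comm_monoid_add"
  shows "(\<Sum>i<4 * n. f i) = (\<Sum>p<n. \<Sum>s<4. f (4 * p + s))"
proof -
  have "(\<Sum>s<4. f (4 * p + s)) = sum f {p * 4..<p * 4 + 4}" for p
    using sum.shift_bounds_nat_ivl[of f 0 "4 * p" 4] by (simp add: lessThan_atLeast0 ac_simps)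
  then show ?thesis using sum.nat_group[of f 4 n] by (simp add: mult.commute)
qed

text \<open>
  Every index is written as \<open>4 * p + s\<close> with \<open>s < 4\<close>.  The index 0, which labels no basis vector, may be
  included since it has \<open>p = 0\<close> and \<open>h\<close> vanishes there.
\<close>

lemma spin_lift_blocks:
  assumes n: "n \<ge> 1" and a: "a 4 > 0" and h: "h \<in> h_alg n"
  shows "spin_lift n a (ad_m n h) \<eta> = (\<Sum>p<n. \<Sum>q<n. spin_block h \<eta> p q)"
proof -
  define G where "G i j = mv_scale (of_real (metric n a (ad_m n h (e_vec n a i)) (e_vec n a j)))
       (mv_scale (1/2) (clifford i (clifford j \<eta>)))" for i j
  define G' where "G' i j = (if 0 < i \<and> i < j then G i j else 0)" for i j
  have h0: "\<And>r. r < n \<Longrightarrow> h $$ (r, 0) = 0" "\<And>r. r < n \<Longrightarrow> h $$ (0, r) = 0"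
    using h unfolding h_alg_iff[OF n] by auto
  have "spin_lift n a (ad_m n h) \<eta> = (\<Sum>i\<in>{1..4 * n - 1}. \<Sum>j\<in>{i<..4 * n - 1}. G i j)"
    by (simp add: spin_lift_def G_def)
  also have "\<dots> = (\<Sum>i\<in>{1..4 * n - 1}. \<Sum>j<4 * n. G' i j)"
  proof (rule sum.cong[OF refl])
    fix i assume "i \<in> {1..4 * n - 1}"
    then show "(\<Sum>j\<in>{i<..4 * n - 1}. G i j) = (\<Sum>j<4 * n. G' i j)"
      by (intro sum.mono_neutral_cong_left) (auto simp: G'_def)
  qed
  also have "\<dots> = (\<Sum>i<4 * n. \<Sum>j<4 * n. G' i j)"
    by (intro sum.mono_neutral_left) (auto simp: G'_def intro!: sum.neutral)
  also have "\<dots> = (\<Sum>p<n. \<Sum>s<4. \<Sum>q<n. \<Sum>t<4. G' (4 * p + s) (4 * q + t))"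
    unfolding sum_four_blocks ..
  also have "\<dots> = (\<Sum>p<n. \<Sum>q<n. \<Sum>s<4. \<Sum>t<4. G' (4 * p + s) (4 * q + t))"
    by (intro sum.cong refl sum.swap)
  also have "\<dots> = (\<Sum>p<n. \<Sum>q<n. spin_block h \<eta> p q)"
    unfolding spin_block_def
  proof (intro sum.cong refl)
    fix p q s t :: nat
    assume p: "p \<in> {..<n}" and q: "q \<in> {..<n}" and s: "s \<in> {..<4}" and t: "t \<in> {..<4}"
    show "G' (4 * p + s) (4 * q + t) =
      (if 4 * p + s < 4 * q + t then clifford_term p q (h $$ (q, p)) s t \<eta> else 0)"
    proof (cases "4 * p + s = 0")
      case True
      then have "h $$ (q, p) = 0" using h0 q by simp
      then show ?thesis using True
        by (simp add: G'_def clifford_term_def qdot_def mv_scale_def zero_fun_def)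
    next
      case False
      show ?thesis
      proof (cases "4 * p + s < 4 * q + t")
        case True
        then have "4 * q + t \<noteq> 0" by auto
        then show ?thesis
          using isotropy_coefficient[of n a h p q s t] n a h p q s t False True
          by (simp add: G'_def G_def clifford_term_def)
      qed (simp add: G'_def)
    qed
  qed
  finally show ?thesis .
qed

lemma spin_block_zero:
  assumes "h $$ (q, p) = 0 \<or> q < p"
  shows "spin_block h \<eta> p q = 0"
  unfolding spin_block_def
  by (intro sum.neutral ballI)
    (use assms in \<open>auto simp: clifford_term_def qdot_def mv_scale_def zero_fun_def\<close>)

text \<open>
  Only the entries of \<open>h\<close> on and below the diagonal contribute, the others being determined by these.
\<close>

lemma spin_lift_single_block:
  assumes n: "n \<ge> 1" and a: "a 4 > 0" and h: "h \<in> h_alg n" and p: "p < n" and q: "q < n"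
    and single: "\<And>r s. r < n \<Longrightarrow> s < n \<Longrightarrow> r \<le> s \<Longrightarrow> h $$ (s, r) \<noteq> 0 \<Longrightarrow> r = p \<and> s = q"
  shows "spin_lift n a (ad_m n h) \<eta> = spin_block h \<eta> p q"
proof -
  have "spin_lift n a (ad_m n h) \<eta> = (\<Sum>r<n. \<Sum>s<n. spin_block h \<eta> r s)"
    by (rule spin_lift_blocks[of n a h, OF n a h])
  also have "\<dots> = (\<Sum>r<n. if r = p then \<Sum>s<n. if s = q then spin_block h \<eta> p q else 0 else 0)"
  proof (intro sum.cong refl)
    fix r assume r: "r \<in> {..<n}"
    have "spin_block h \<eta> r s = (if r = p \<and> s = q then spin_block h \<eta> p q else 0)" if "s < n" for s
      using spin_block_zero[of h s r \<eta>] single[of r s] r that by fastforce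
    then show "(\<Sum>s<n. spin_block h \<eta> r s) =
        (if r = p then \<Sum>s<n. if s = q then spin_block h \<eta> p q else 0 else 0)"
      by (auto intro!: sum.cong sum.neutral)
  qed
  also have "\<dots> = spin_block h \<eta> p q" using p q by simp
  finally show ?thesis .
qed

lemma spin_block_off_diagonal:
  assumes "p < q"
  shows "spin_block h \<eta> p q = (\<Sum>s<4. \<Sum>t<4. clifford_term p q (h $$ (q, p)) s t \<eta>)"
  unfolding spin_block_def by (intro sum.cong refl) (use assms in auto)

lemma spin_block_diagonal:
  "spin_block h \<eta> p p = (\<Sum>s<4. \<Sum>t<4. if s < t then clifford_term p p (h $$ (p, p)) s t \<eta> else 0)"
  unfolding spin_block_def by (intro sum.cong refl) auto

lemma degree_spinors_spin_module: "degree_spinors n \<subseteq> spin_module n"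
  by (auto simp: degree_spinors_def spin_module_def paired_def)

lemma degree_spinors_invariant:
  assumes n: "n \<ge> 1" and a: "a 4 > 0"
  shows "degree_spinors n \<subseteq> invariant_spinors n a"
proof
  fix \<eta> assume \<eta>: "\<eta> \<in> degree_spinors n"
  then have mem: "\<eta> \<in> spin_module n" using degree_spinors_spin_module by blast
  then have fin: "finitary \<eta>" by (rule finitary_spin_module)
  have partner: "partner (2 * k) = 2 * k + 1" "partner (2 * k + 1) = 2 * k" for k
    by (simp_all add: partner_def)
  have "spin_lift n a (ad_m n h) \<eta> = 0" if h: "h \<in> h_alg n" for h
  proof -
    have h0: "\<And>r. r < n \<Longrightarrow> h $$ (r, 0) = 0" "\<And>r. r < n \<Longrightarrow> h $$ (0, r) = 0"
      and hs: "\<And>r s. r < n \<Longrightarrow> s < n \<Longrightarrow> quat_cnj (h $$ (s, r)) = - h $$ (r, s)"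
      using h unfolding h_alg_iff[OF n] by auto
    have "spin_block h \<eta> p q = 0" if pq: "p < n" "q < n" for p q
    proof (cases "p = 0 \<or> q = 0 \<or> q < p")
      case True
      then show ?thesis using h0 pq by (intro spin_block_zero) auto
    next
      case False
      then have p: "p \<noteq> 0" and q: "q \<noteq> 0" by auto
      have range: "2 * p \<in> {2..2 * n - 1}" "2 * p + 1 \<in> {2..2 * n - 1}"
         "2 * q \<in> {2..2 * n - 1}" "2 * q + 1 \<in> {2..2 * n - 1}"
        using p q pq by auto
      obtain \<alpha> \<beta> \<gamma> \<delta> where u: "h $$ (q, p) = Quat \<alpha> \<beta> \<gamma> \<delta>" by (cases "h $$ (q, p)")
      show ?thesis
      proof (cases "p = q")
        case True
        have "\<alpha> = 0" using hs[OF pq(1) pq(1)] u True by (simp add: quat_eq_iff)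
        then have u: "h $$ (p, p) = Quat 0 \<beta> \<gamma> \<delta>" using u True by simp
        show ?thesis
          using degree_spinors_number[OF \<eta> range(1)] degree_spinors_partner[OF \<eta> range(1)]
            degree_spinors_partner[OF \<eta> range(2)]
          unfolding True[symmetric] spin_block_diagonal u fun_eq_iff diagonal_block[OF fin p] partner
          by simp
      next
        case False
        then have lt: "p < q" using \<open>\<not> (p = 0 \<or> q = 0 \<or> q < p)\<close> by auto
        have ne: "2 * p \<noteq> 2 * q" "2 * p \<noteq> 2 * q + 1" "2 * p + 1 \<noteq> 2 * q" "2 * p + 1 \<noteq> 2 * q + 1"
          "2 * q \<noteq> 2 * p" "2 * q + 1 \<noteq> 2 * p"
          using lt by presburger+
        show ?thesis
          using degree_spinors_exchange[OF \<eta> range(3) range(1), unfolded partner, OF ne(1,2)]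
            degree_spinors_exchange[OF \<eta> range(1) range(3), unfolded partner, OF ne(5) ne(3)[symmetric]]
            degree_spinors_exchange[OF \<eta> range(1) range(4), unfolded partner, OF ne(6) ne(4)[symmetric]]
            degree_spinors_exchange[OF \<eta> range(4) range(1), unfolded partner, OF ne(2,1)]
          unfolding spin_block_off_diagonal[OF lt] u fun_eq_iff off_diagonal_block[OF fin p q False]
          by simp
      qed
    qed
    then show ?thesis unfolding spin_lift_blocks[of n a h, OF n a h] by simp
  qed
  then show "\<eta> \<in> invariant_spinors n a" using mem by (simp add: invariant_spinors_def)
qed

text \<open>
  Tested against the matrix with the single entry \<open>i\<close> at \<open>(p, p)\<close>, whose spin lift multiplies the
  coefficient at \<open>S\<close> by \<open>\<i>\<close> times the difference of the occupation numbers of \<open>2p + 1\<close> and \<open>2p\<close>.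
\<close>

lemma invariant_support:
  assumes n: "n \<ge> 1" and a: "a 4 > 0" and \<psi>: "\<psi> \<in> invariant_spinors n a" and S: "\<psi> S \<noteq> 0"
  shows "paired n S"
proof -
  have mem: "\<psi> \<in> spin_module n" using \<psi> by (simp add: invariant_spinors_def)
  then have fin: "finitary \<psi>" by (rule finitary_spin_module)
  have "2 * p \<in> S \<longleftrightarrow> 2 * p + 1 \<in> S" if p: "p \<in> {1..<n}" for p
  proof -
    define h where "h = mat n n (\<lambda>(r, s). if r = p \<and> s = p then quat_i else 0)"
    have h: "h \<in> h_alg n"
      unfolding h_alg_iff[OF n] using p by (auto simp: h_def quat_eq_iff)
    have hpp: "h $$ (p, p) = Quat 0 1 0 0" using p by (simp add: h_def quat_i_def)
    have "spin_lift n a (ad_m n h) \<psi> = 0" using \<psi> h by (simp add: invariant_spinors_def)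
    moreover have "spin_lift n a (ad_m n h) \<psi> = spin_block h \<psi> p p"
      by (rule spin_lift_single_block[of n a h, OF n a h]) (use p in \<open>auto simp: h_def split: if_splits\<close>)
    ultimately have "spin_block h \<psi> p p S = 0" by simp
    then show ?thesis
      using S p unfolding spin_block_diagonal hpp
      by (subst (asm) diagonal_block[OF fin]) (auto simp: create_contract_same split: if_splits)
  qed
  then show ?thesis using mem S by (auto simp: paired_def spin_module_def)
qed

text \<open>
  Tested against the real rotation in the plane of the indices \<open>p\<close> and \<open>q\<close>, at a suitable set.
\<close>

lemma invariant_exchange:
  assumes n: "n \<ge> 1" and a: "a 4 > 0" and \<psi>: "\<psi> \<in> invariant_spinors n a"
    and p: "1 \<le> p" and pq: "p < q" and q: "q < n"
    and T: "T \<inter> {2 * p, 2 * p + 1, 2 * q, 2 * q + 1} = {}"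
  shows "\<psi> (insert (2 * p) (insert (2 * p + 1) T)) = \<psi> (insert (2 * q) (insert (2 * q + 1) T))"
proof -
  have fin: "finitary \<psi>" using \<psi> by (auto simp: invariant_spinors_def intro: finitary_spin_module)
  define h where "h = mat n n (\<lambda>(r, s). if r = q \<and> s = p then 1 else if r = p \<and> s = q then -1 else (0::quat))"
  have h: "h \<in> h_alg n"
    unfolding h_alg_iff[OF n] using p pq q by (auto simp: h_def quat_eq_iff)
  have hqp: "h $$ (q, p) = Quat 1 0 0 0" using pq q by (simp add: h_def one_quat_def)
  have "spin_lift n a (ad_m n h) \<psi> = 0" using \<psi> h by (simp add: invariant_spinors_def)
  moreover have "spin_lift n a (ad_m n h) \<psi> = spin_block h \<psi> p q"
    by (rule spin_lift_single_block[of n a h, OF n a h]) (use pq q in \<open>auto simp: h_def split: if_splits\<close>)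
  ultimately have zero: "spin_block h \<psi> p q S = 0" for S by simp
  \<comment> \<open>half of the pair \<open>p\<close> and half of the pair \<open>q\<close>: of the four terms of the block, only the two that
    complete one of the pairs survive at this set\<close>
  define S where "S = insert (2 * q) (insert (2 * p + 1) T)"
  have ne: "2 * p \<noteq> 2 * q" "2 * p \<noteq> 2 * q + 1" "2 * p + 1 \<noteq> 2 * q" "2 * p + 1 \<noteq> 2 * q + 1"
    using pq by presburger+
  have "2 * p \<notin> S" "2 * q + 1 \<notin> S" using T ne by (auto simp: S_def)
  then have z: "create (2 * p) \<zeta> S = 0" "create (2 * q + 1) \<zeta> S = 0" for \<zeta> by (simp_all add: create_def)
  have "create (2 * q) (contract (2 * p) \<psi>) S = create (2 * p + 1) (contract (2 * q + 1) \<psi>) S"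
    using zero[of S] p pq unfolding spin_block_off_diagonal[OF pq] hqp
    by (subst (asm) off_diagonal_block[OF fin]) (auto simp: z[unfolded One_nat_def, simplified])
  moreover have partner: "partner (2 * k) = 2 * k + 1" for k by (simp add: partner_def)
  moreover have "\<exists>c. c \<noteq> 0 \<and>
      create (2 * q) (contract (2 * p) \<psi>) S = c * \<psi> (insert (2 * p) (insert (2 * p + 1) T)) \<and>
      create (2 * p + 1) (contract (2 * q + 1) \<psi>) S =
        (-1) ^ (2 * q + 2 * p) * c * \<psi> (insert (2 * q) (insert (2 * q + 1) T))"
    using exchange_coeffs[of "2 * q" "2 * p" T \<psi>] p pq ne T unfolding partner S_def by auto
  ultimately show ?thesis by (auto simp: power_add power_mult)
qed

text \<open>
  Two paired sets of the same size agree on the index 1 by parity, so if they differ, each contains a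
  pair that the other one misses.  Exchanging these pairs in the first set brings it closer to the
  second one.
\<close>

lemma invariant_depends_on_card:
  assumes n: "n \<ge> 1" and a: "a 4 > 0" and \<psi>: "\<psi> \<in> invariant_spinors n a"
    and S: "paired n S" and S': "paired n S'" and card: "card S = card S'"
  shows "\<psi> S = \<psi> S'"
  using S card
proof (induction "card (S - S')" arbitrary: S rule: less_induct)
  case less
  note S = less.prems(1) and card = less.prems(2)
  have fin: "finite S" "finite S'" using S S' by (auto intro: finite_paired)
  show ?case
  proof (cases "S \<subseteq> S'")
    case True
    then have "S = S'" using fin card by (intro card_subset_eq) auto
    then show ?thesis by simp
  next
    case False
    have one: "1 \<in> S \<longleftrightarrow> 1 \<in> S'"
      using card_paired[OF S] card_paired[OF S'] card by (auto split: if_splits) presburger+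
    have pair: "\<exists>p\<in>{1..<n}. 2 * p \<in> A \<and> 2 * p + 1 \<in> A \<and> 2 * p \<notin> B \<and> 2 * p + 1 \<notin> B"
      if A: "paired n A" and B: "paired n B" and AB: "\<not> A \<subseteq> B" "1 \<in> A \<longleftrightarrow> 1 \<in> B" for A B
    proof -
      obtain x where x: "x \<in> A" "x \<notin> B" using AB by auto
      then have "x \<in> {1..2 * n - 1}" using A by (auto simp: paired_def)
      then show ?thesis
        by (rule subset_pairs_cases) (use x A B AB in \<open>auto simp: paired_def\<close>)
    qed
    have "\<not> S' \<subseteq> S" using False fin card card_subset_eq by metis
    then obtain p q where p: "p \<in> {1..<n}" "2 * p \<in> S" "2 * p + 1 \<in> S" "2 * p \<notin> S'" "2 * p + 1 \<notin> S'"
      and q: "q \<in> {1..<n}" "2 * q \<in> S'" "2 * q + 1 \<in> S'" "2 * q \<notin> S" "2 * q + 1 \<notin> S"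
      using pair[OF S S' False one] pair[OF S' S _ one[symmetric]] by blast
    define T where "T = S - {2 * p, 2 * p + 1}"
    define S2 where "S2 = insert (2 * q) (insert (2 * q + 1) T)"
    have ST: "S = insert (2 * p) (insert (2 * p + 1) T)" using p by (auto simp: T_def)
    have T: "T \<inter> {2 * p, 2 * p + 1, 2 * q, 2 * q + 1} = {}"
      "T \<inter> {2 * q, 2 * q + 1, 2 * p, 2 * p + 1} = {}" using q by (auto simp: T_def)
    have "p \<noteq> q" using p q by auto
    then have "\<psi> S = \<psi> S2"
      using invariant_exchange[of n a \<psi>, OF n a \<psi> _ _ _ T(1)] invariant_exchange[of n a \<psi>, OF n a \<psi> _ _ _ T(2)] p(1) q(1)
      unfolding ST S2_def by (cases "p < q") auto
    moreover have "\<psi> S2 = \<psi> S'"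
    proof (rule less.hyps)
      have finT: "finite T" using fin by (simp add: T_def)
      show "paired n S2"
        using paired_remove_pair[OF q(1), of S2] paired_remove_pair[OF p(1), of S] p S T
        by (auto simp: S2_def T_def)
      show "card S2 = card S'"
        using T finT card unfolding ST S2_def by simp
      show "card (S2 - S') < card (S - S')"
        using p q fin by (intro psubset_card_mono) (auto simp: S2_def T_def)
    qed
    ultimately show ?thesis by simp
  qed
qed

theorem theorem4p11:
  fixes n :: nat and a :: "nat \<Rightarrow> real"
  assumes "n \<ge> 1"
    and "a 1 > 0" "a 2 > 0" "a 3 > 0" "a 4 > 0"
  shows "invariant_spinors n a =
    mv_span (\<Union>j \<in> {0..n - 1}.
      {wedge_power (omega n) j, wedge (y_vec 1) (wedge_power (omega n) j)})"
proof -
  have "invariant_spinors n a \<subseteq> degree_spinors n"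
    using invariant_support[of n a, OF assms(1,5)] invariant_depends_on_card[of n a, OF assms(1,5)]
    unfolding degree_spinors_def by blast
  then have "invariant_spinors n a = degree_spinors n"
    using degree_spinors_invariant[of n a, OF assms(1,5)] by blast
  then show ?thesis using degree_spinors_eq_span[OF assms(1)] by simp
qed

end
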